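(* Consider the multinomial choice model described in the context, and suppose that for all $y\ne0$, $\boldsymbol\varepsilon_y=\boldsymbol\theta^{\sf T}\mathbf w_y+\boldsymbol\zeta_y$, where $\boldsymbol\theta$ and $\boldsymbol\zeta=(\boldsymbol\zeta_y)_{y\in Y\setminus\{0\}}$ are random coefficients and $\mathbf w_y$ is the vector of product-$y$-specific covariates, $\mathbf w=(\mathbf w_y)_{y\in Y\setminus\{0\}}$. Suppose: (i) all of the following hold: (a) $p_0(x)=\Pr(\mathbf y=0\mid\mathbf x=x)$ is known (identified) for all $x\in X$; (b) for all $w\in W$, $\boldsymbol\varepsilon$ is conditionally independent of $(\mathbf e,\mathbf d,\mathbf z)$ given $\mathbf w=w$, and $\mathbf e$ is conditionally independent of $(\mathbf d,\mathbf z)$ given $\mathbf w=w$; (c) for all $w\in W$: conditional on $\mathbf w=w$, $\mathbf e$ has mean zero and variance one; for some $\bar y\in Y\setminus\{0\}$, $F_{\boldsymbol\varepsilon|\mathbf w}(\cdot|w)$ has bounded partial derivatives with respect to $\varepsilon_{\bar y}$ up to order $\kappa$ with $\partial^l_{\varepsilon^l_{\bar y}}F_{\boldsymbol\varepsilon|\mathbf w}(\varepsilon|w)|_{\varepsilon=0}\ne0$ for all $l\le\kappa$; and there exists $d^*$ such that the support of $(\mathbf d,\mathbf z)$ conditional on $\mathbf w=w$ contains $(d^*,0)$ with an open neighborhood; (d) with $\mathbf v=\beta_0(\mathbf w)+\beta_1(\mathbf w)\mathbf d+\mathbf e$, $F_{\mathbf v|\mathbf x}$ is identified and the family $\{F_{\mathbf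 v|\mathbf x}(\cdot|(d,z,w)),\ d\in D_{(z,w)}\}$ is boundedly complete for all $(z,w)$ in the support; (ii) $R_w=\mathbb R^J$ for all $w\in W$, where $R_w=\{r\in\mathbb R^J: r=vz,\ z\in Z_w,\ v\in V_w\}$; (iii) $(\boldsymbol\theta,\boldsymbol\zeta)$ and $\mathbf w$ are independent; (iv) the support of $\mathbf w$ contains an open ball of the dimensionality of $\mathbf w$; (v) $(\boldsymbol\theta,\boldsymbol\zeta)$ has finite absolute moments and its distribution is uniquely determined by its moments. Then $\beta_0$, $\beta_1$, and the distribution of $(\mathbf e,\boldsymbol\theta,\boldsymbol\zeta)$ are identified.
   Context: Model. An agent chooses $\mathbf y\in Y=\{0,1,\dots,J\}$ to maximize utility. The utility of $y=0$ is normalized to $0$; the utility of $y\ne0$ is $$\mathbf z_y\big[\beta_0(\mathbf w)+\beta_1(\mathbf w)\mathbf d+\mathbf e\big]+\boldsymbol\varepsilon_y .$$ Here $\mathbf z=(\mathbf z_y)_{y\ne0}\in\mathbb R^J$, $\mathbf d\in\mathbb R$ and $\mathbf w\in W\subseteq\mathbb R^{d_w}$ are observed covariates; $\mathbf x=(\mathbf d,\mathbf z,\mathbf w)$ has support $X$; $\mathbf e\in\mathbb R$ and $\boldsymbol\varepsilon=(\boldsymbol\varepsilon_y)_{y\neq0}\in\mathbb R^J$ are latent; $\beta_0,\beta_1:W\to\mathbb R$ are unknown functions with $\beta_1(w)\ne0$ for all $w\in W$. Ties with the outside option are resolved in favor of $0$, so that, under the conditional independence assumptions, $p_0(x)=\int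 F_{\boldsymbol\varepsilon|\mathbf w}(-z_1v,\dots,-z_Jv|w)\,dF_{\mathbf v|\mathbf x}(v|x)$. Notation. $\kappa\le\infty$ is an order of differentiability (possibly infinite). $D_{(z,w)}$ is the support of $\mathbf d$ conditional on $(\mathbf z,\mathbf w)=(z,w)$; $Z_w$ and $V_w$ are the supports of $\mathbf z$ and $\mathbf v$ conditional on $\mathbf w=w$. Bounded completeness. The family $\{F_{\mathbf v|\mathbf x}(\cdot|x),x\in X'\}$ is boundedly complete if for any bounded function $g$: $\int g(t)\,dF_{\mathbf v|\mathbf x}(t|x)=0$ for all $x\in X'$ implies $g(\mathbf v)=0$ a.s. Identification. A feature of the model is identified if any two structures satisfying all the stated assumptions and generating the same $p_0$ on $X$ have the same value of that feature. (That $F_{\mathbf v|\mathbf x}$ is identified means it may be treated as known.)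
   Formalization: The joint distribution of (e, θ, ζ) is identified only among structures where (θ, ζ) is conditionally independent of e given w; without this it is false (e = (θ − wζ)/√(1+w²), normal θ, ζ). β0, β1 and the laws of e and of (θ, ζ) are identified as stated. *)

theory Defs
  imports "HOL-Probability.Probability" "HOL-Library.Extended_Nat"
begin

text \<open>
  The inside options are the elements of the finite type \<open>'j\<close>, so that \<open>Y\<close> is \<open>'j option\<close> with
  \<open>None\<close> as the outside option and \<open>J\<close> is the cardinality of \<open>'j\<close>; each \<open>w\<^sub>y\<close> is a vector indexed
  by the finite type \<open>'k\<close>.  Covariates are triples \<open>x = (d, z, w)\<close> and latent variables are
  triples \<open>(e, \<theta>, \<zeta>)\<close>.
\<close>

type_synonym ('k, 'j) covs = "(real ^ 'k) ^ 'j"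
type_synonym ('k, 'j) xvar = "real \<times> (real ^ 'j) \<times> ('k, 'j) covs"
type_synonym ('k, 'j) latent = "real \<times> (real ^ 'k) \<times> (real ^ 'j)"

definition msupport :: "'a::topological_space measure \<Rightarrow> 'a set" where
  "msupport M = {x. \<forall>U. open U \<longrightarrow> x \<in> U \<longrightarrow> emeasure M U > 0}"

text \<open>The library's \<open>indep_var\<close> requires both random variables to have the same type.\<close>

definition indep_rv ::
    "'a measure \<Rightarrow> ('a \<Rightarrow> 'b::topological_space) \<Rightarrow> ('a \<Rightarrow> 'c::topological_space) \<Rightarrow> bool" where
  "indep_rv M X Y \<longleftrightarrow> X \<in> borel_measurable M \<and> Y \<in> borel_measurable M \<and>
     prob_space.indep_set M {X -` A \<inter> space M | A. A \<in> sets borel}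
                            {Y -` B \<inter> space M | B. B \<in> sets borel}"


section \<open>Observables\<close>

text \<open>
  The distribution of \<open>x\<close> is observed, hence common to all structures.  It is given by the law of
  \<open>w\<close>, the conditional law of \<open>z\<close> given \<open>w\<close>, and the conditional law of \<open>d\<close> given \<open>(z, w)\<close>.
\<close>

record ('k, 'j) observables =
  law_w :: "('k::finite, 'j::finite) covs measure"
  ker_z :: "('k, 'j) covs \<Rightarrow> (real ^ 'j) measure"
  ker_d :: "(real ^ 'j) \<times> ('k, 'j) covs \<Rightarrow> real measure"

definition law_x :: "('k::finite, 'j::finite) observables \<Rightarrow> ('k, 'j) xvar measure" where
  "law_x ob = law_w ob \<bind> (\<lambda>w. ker_z ob w \<bind> (\<lambda>z. ker_d ob (z, w) \<bind>
     (\<lambda>d. return borel (d, z, w))))"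

definition law_dz ::
    "('k::finite, 'j::finite) observables \<Rightarrow> ('k, 'j) covs \<Rightarrow> (real \<times> (real ^ 'j)) measure" where
  "law_dz ob w = ker_z ob w \<bind> (\<lambda>z. ker_d ob (z, w) \<bind> (\<lambda>d. return borel (d, z)))"

definition supp_x :: "('k::finite, 'j::finite) observables \<Rightarrow> ('k, 'j) xvar set" where
  "supp_x ob = msupport (law_x ob)"

definition supp_w :: "('k::finite, 'j::finite) observables \<Rightarrow> ('k, 'j) covs set" where
  "supp_w ob = msupport (law_w ob)"

definition supp_z :: "('k::finite, 'j::finite) observables \<Rightarrow> ('k, 'j) covs \<Rightarrow> (real ^ 'j) set" where
  "supp_z ob w = msupport (ker_z ob w)"

definition supp_d ::
    "('k::finite, 'j::finite) observables \<Rightarrow> real ^ 'j \<Rightarrow> ('k, 'j) covs \<Rightarrow> real set" where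
  "supp_d ob z w = msupport (ker_d ob (z, w))"

text \<open>
  Conditional laws are determined only up to null sets, whereas the model speaks about every point
  of the supports.  The last conjunct fixes versions whose conditional supports are compatible with
  the support of \<open>x\<close>; any version has this property for almost all \<open>w\<close> and \<open>z\<close>.
\<close>

definition valid_observables :: "('k::finite, 'j::finite) observables \<Rightarrow> bool" where
  "valid_observables ob \<longleftrightarrow>
     prob_space (law_w ob) \<and> sets (law_w ob) = sets borel \<and>
     ker_z ob \<in> borel \<rightarrow>\<^sub>M prob_algebra borel \<and>
     ker_d ob \<in> borel \<rightarrow>\<^sub>M prob_algebra borel \<and>
     (\<forall>w\<in>supp_w ob. \<forall>z\<in>supp_z ob w. \<forall>d\<in>supp_d ob z w. (d, z, w) \<in> supp_x ob)"


section \<open>Structures\<close>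

text \<open>\<open>ker_lat S x\<close> is the conditional law of \<open>(e, \<theta>, \<zeta>)\<close> given \<open>x\<close>.\<close>

record ('k, 'j) struct =
  beta0 :: "('k::finite, 'j::finite) covs \<Rightarrow> real"
  beta1 :: "('k, 'j) covs \<Rightarrow> real"
  ker_lat :: "('k, 'j) xvar \<Rightarrow> ('k, 'j) latent measure"

definition lat_e :: "('k::finite, 'j::finite) latent \<Rightarrow> real" where
  "lat_e = (\<lambda>(e, \<theta>, \<zeta>). e)"

definition lat_coef :: "('k::finite, 'j::finite) latent \<Rightarrow> (real ^ 'k) \<times> (real ^ 'j)" where
  "lat_coef = (\<lambda>(e, \<theta>, \<zeta>). (\<theta>, \<zeta>))"

definition lat_eps :: "('k::finite, 'j::finite) covs \<Rightarrow> ('k, 'j) latent \<Rightarrow> real ^ 'j" where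
  "lat_eps w = (\<lambda>(e, \<theta>, \<zeta>). \<chi> y. \<theta> \<bullet> (w $ y) + \<zeta> $ y)"

definition index_v ::
    "('k::finite, 'j::finite) struct \<Rightarrow> ('k, 'j) covs \<Rightarrow> real \<Rightarrow> ('k, 'j) latent \<Rightarrow> real" where
  "index_v S w d l = beta0 S w + beta1 S w * d + lat_e l"

fun utility ::
    "('k::finite, 'j::finite) struct \<Rightarrow> ('k, 'j) xvar \<Rightarrow> ('k, 'j) latent \<Rightarrow> 'j option \<Rightarrow> real" where
  "utility S (d, z, w) l None = 0"
| "utility S (d, z, w) l (Some y) =
     z $ y * (beta0 S w + beta1 S w * d + lat_e l) + lat_eps w l $ y"

text \<open>Ties are resolved in favour of the outside option.\<close>

definition p0 :: "('k::finite, 'j::finite) struct \<Rightarrow> ('k, 'j) xvar \<Rightarrow> real" where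
  "p0 S x = measure (ker_lat S x)
     {l \<in> space (ker_lat S x). \<forall>y. utility S x l y \<le> utility S x l None}"

definition law_v_x :: "('k::finite, 'j::finite) struct \<Rightarrow> ('k, 'j) xvar \<Rightarrow> real measure" where
  "law_v_x S = (\<lambda>(d, z, w). distr (ker_lat S (d, z, w)) borel (index_v S w d))"

text \<open>Joint law of \<open>(d, z, (e, \<theta>, \<zeta>))\<close> conditional on \<open>w\<close>, and of \<open>(w, d, z, (e, \<theta>, \<zeta>))\<close>.\<close>

definition law_given_w ::
    "('k::finite, 'j::finite) observables \<Rightarrow> ('k, 'j) struct \<Rightarrow> ('k, 'j) covs \<Rightarrow>
      (real \<times> (real ^ 'j) \<times> ('k, 'j) latent) measure" where
  "law_given_w ob S w = ker_z ob w \<bind> (\<lambda>z. ker_d ob (z, w) \<bind> (\<lambda>d. ker_lat S (d, z, w) \<bind>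
     (\<lambda>l. return borel (d, z, l))))"

definition law_all ::
    "('k::finite, 'j::finite) observables \<Rightarrow> ('k, 'j) struct \<Rightarrow>
      (('k, 'j) covs \<times> real \<times> (real ^ 'j) \<times> ('k, 'j) latent) measure" where
  "law_all ob S = law_w ob \<bind> (\<lambda>w. law_given_w ob S w \<bind> (\<lambda>r. return borel (w, r)))"

definition law_e_w ::
    "('k::finite, 'j::finite) observables \<Rightarrow> ('k, 'j) struct \<Rightarrow> ('k, 'j) covs \<Rightarrow> real measure" where
  "law_e_w ob S w = distr (law_given_w ob S w) borel (\<lambda>(d, z, l). lat_e l)"

definition cdf_eps_w ::
    "('k::finite, 'j::finite) observables \<Rightarrow> ('k, 'j) struct \<Rightarrow> ('k, 'j) covs \<Rightarrow>
      real ^ 'j \<Rightarrow> real" where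
  "cdf_eps_w ob S w t = measure (law_given_w ob S w)
     {r \<in> space (law_given_w ob S w). case r of (d, z, l) \<Rightarrow> \<forall>y. lat_eps w l $ y \<le> t $ y}"

definition supp_v ::
    "('k::finite, 'j::finite) observables \<Rightarrow> ('k, 'j) struct \<Rightarrow> ('k, 'j) covs \<Rightarrow> real set" where
  "supp_v ob S w = msupport (distr (law_given_w ob S w) borel (\<lambda>(d, z, l). index_v S w d l))"

definition law_e :: "('k::finite, 'j::finite) observables \<Rightarrow> ('k, 'j) struct \<Rightarrow> real measure" where
  "law_e ob S = distr (law_all ob S) borel (\<lambda>(w, d, z, l). lat_e l)"

definition law_coef ::
    "('k::finite, 'j::finite) observables \<Rightarrow> ('k, 'j) struct \<Rightarrow>
      ((real ^ 'k) \<times> (real ^ 'j)) measure" where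
  "law_coef ob S = distr (law_all ob S) borel (\<lambda>(w, d, z, l). lat_coef l)"

definition law_latent ::
    "('k::finite, 'j::finite) observables \<Rightarrow> ('k, 'j) struct \<Rightarrow> ('k, 'j) latent measure" where
  "law_latent ob S = distr (law_all ob S) borel (\<lambda>(w, d, z, l). l)"


section \<open>Assumptions\<close>

definition valid_struct ::
    "('k::finite, 'j::finite) observables \<Rightarrow> ('k, 'j) struct \<Rightarrow> bool" where
  "valid_struct ob S \<longleftrightarrow>
     ker_lat S \<in> borel \<rightarrow>\<^sub>M prob_algebra borel \<and> (\<forall>w\<in>supp_w ob. beta1 S w \<noteq> 0)"

text \<open>
  The first two conjuncts are the conditional independence assumptions.  They imply that for almost
  all \<open>x\<close> the law of \<open>(e, \<epsilon>)\<close> given \<open>x\<close> is its law given \<open>w\<close>; the last conjunct fixes the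
  version of the conditional law given \<open>x\<close> for which this holds at every point of the support, so
  that the formula for \<open>p\<^sub>0 (x)\<close> as the integral of the distribution function of \<open>\<epsilon>\<close> given \<open>w\<close>
  holds there, not just almost everywhere.
\<close>

definition cond_independence ::
    "('k::finite, 'j::finite) observables \<Rightarrow> ('k, 'j) struct \<Rightarrow> bool" where
  "cond_independence ob S \<longleftrightarrow>
     (\<forall>w\<in>supp_w ob.
        indep_rv (law_given_w ob S w) (\<lambda>(d, z, l). lat_eps w l) (\<lambda>(d, z, l). (lat_e l, d, z)) \<and>
        indep_rv (law_given_w ob S w) (\<lambda>(d, z, l). lat_e l) (\<lambda>(d, z, l). (d, z))) \<and>
     (\<forall>(d, z, w)\<in>supp_x ob.
        distr (ker_lat S (d, z, w)) borel (\<lambda>l. (lat_e l, lat_eps w l)) =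
        distr (law_given_w ob S w) borel (\<lambda>(d, z, l). (lat_e l, lat_eps w l)))"

definition partial :: "'j::finite \<Rightarrow> (real ^ 'j \<Rightarrow> real) \<Rightarrow> real ^ 'j \<Rightarrow> real" where
  "partial y f t = deriv (\<lambda>s. f (t + s *\<^sub>R axis y 1)) 0"

definition bounded_partials :: "enat \<Rightarrow> 'j::finite \<Rightarrow> (real ^ 'j \<Rightarrow> real) \<Rightarrow> bool" where
  "bounded_partials \<kappa> y f \<longleftrightarrow>
     (\<forall>l. enat (Suc l) \<le> \<kappa> \<longrightarrow>
        (\<forall>t. (\<lambda>s. (partial y ^^ l) f (t + s *\<^sub>R axis y 1)) differentiable at 0) \<and>
        bounded (range ((partial y ^^ Suc l) f)))"

definition normalization ::
    "enat \<Rightarrow> ('k::finite, 'j::finite) observables \<Rightarrow> ('k, 'j) struct \<Rightarrow> bool" where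
  "normalization \<kappa> ob S \<longleftrightarrow> (\<forall>w\<in>supp_w ob.
     (integrable (law_e_w ob S w) (\<lambda>e. e) \<and> integrable (law_e_w ob S w) (\<lambda>e. e\<^sup>2) \<and>
      prob_space.expectation (law_e_w ob S w) (\<lambda>e. e) = 0 \<and>
      prob_space.variance (law_e_w ob S w) (\<lambda>e. e) = 1) \<and>
     (\<exists>y. bounded_partials \<kappa> y (cdf_eps_w ob S w) \<and>
          (\<forall>l. 1 \<le> l \<longrightarrow> enat l \<le> \<kappa> \<longrightarrow> (partial y ^^ l) (cdf_eps_w ob S w) 0 \<noteq> 0)) \<and>
     (\<exists>ds U. open U \<and> (ds, 0) \<in> U \<and> U \<subseteq> msupport (law_dz ob w)))"

definition boundedly_complete :: "real measure set \<Rightarrow> bool" where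
  "boundedly_complete F \<longleftrightarrow>
     (\<forall>g :: real \<Rightarrow> real. g \<in> borel_measurable borel \<longrightarrow> bounded (range g) \<longrightarrow>
        (\<forall>N\<in>F. (LINT t|N. g t) = 0) \<longrightarrow> (\<forall>N\<in>F. AE t in N. g t = 0))"

definition v_complete ::
    "('k::finite, 'j::finite) observables \<Rightarrow> ('k, 'j) struct \<Rightarrow> bool" where
  "v_complete ob S \<longleftrightarrow> (\<forall>w\<in>supp_w ob. \<forall>z\<in>supp_z ob w.
     boundedly_complete {law_v_x S (d, z, w) | d. d \<in> supp_d ob z w})"

definition index_range ::
    "('k::finite, 'j::finite) observables \<Rightarrow> ('k, 'j) struct \<Rightarrow> ('k, 'j) covs \<Rightarrow>
      (real ^ 'j) set" where
  "index_range ob S w = {v *\<^sub>R z | v z. z \<in> supp_z ob w \<and> v \<in> supp_v ob S w}"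

definition coef_indep_w ::
    "('k::finite, 'j::finite) observables \<Rightarrow> ('k, 'j) struct \<Rightarrow> bool" where
  "coef_indep_w ob S \<longleftrightarrow>
     indep_rv (law_all ob S) (\<lambda>(w, d, z, l). lat_coef l) (\<lambda>(w, d, z, l). w)"

definition monomial ::
    "('k::finite \<Rightarrow> nat) \<Rightarrow> ('j::finite \<Rightarrow> nat) \<Rightarrow> (real ^ 'k) \<times> (real ^ 'j) \<Rightarrow> real" where
  "monomial a b = (\<lambda>(\<theta>, \<zeta>). (\<Prod>i\<in>UNIV. \<theta> $ i ^ a i) * (\<Prod>y\<in>UNIV. \<zeta> $ y ^ b y))"

definition finite_abs_moments ::
    "((real ^ 'k::finite) \<times> (real ^ 'j::finite)) measure \<Rightarrow> bool" where
  "finite_abs_moments M \<longleftrightarrow> (\<forall>a b. integrable M (\<lambda>u. \<bar>monomial a b u\<bar>))"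

definition moment_determinate ::
    "((real ^ 'k::finite) \<times> (real ^ 'j::finite)) measure \<Rightarrow> bool" where
  "moment_determinate M \<longleftrightarrow>
     (\<forall>N. prob_space N \<longrightarrow> sets N = sets borel \<longrightarrow> finite_abs_moments N \<longrightarrow>
        (\<forall>a b. (LINT u|N. monomial a b u) = (LINT u|M. monomial a b u)) \<longrightarrow> N = M)"

text \<open>
  This is not implied by the assumptions above, which make only \<open>\<theta>\<^sup>T w\<^sub>y + \<zeta>\<^sub>y\<close>, and not \<open>(\<theta>, \<zeta>)\<close>,
  conditionally independent of \<open>e\<close>.  Without it the joint law of \<open>(e, \<theta>, \<zeta>)\<close> need not be
  identified: for \<open>J = 1\<close>, scalar \<open>w\<close> and independent normal \<open>\<theta>\<close> and \<open>\<zeta>\<close> with variance one,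
  taking \<open>e\<close> to be the standardization of \<open>\<theta> - w \<zeta>\<close>, which is independent of \<open>\<theta> w + \<zeta>\<close> given \<open>w\<close>,
  yields the same choice probabilities as taking \<open>e\<close> standard normal and independent of \<open>(\<theta>, \<zeta>)\<close>.
\<close>

definition coef_cond_indep_e ::
    "('k::finite, 'j::finite) observables \<Rightarrow> ('k, 'j) struct \<Rightarrow> bool" where
  "coef_cond_indep_e ob S \<longleftrightarrow> (\<forall>w\<in>supp_w ob.
     indep_rv (law_given_w ob S w) (\<lambda>(d, z, l). lat_coef l) (\<lambda>(d, z, l). lat_e l))"


section \<open>Identification\<close>

definition identified ::
    "('k::finite, 'j::finite) observables \<Rightarrow> ('k, 'j) struct set \<Rightarrow>
      (('k, 'j) struct \<Rightarrow> 'a) \<Rightarrow> bool" where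
  "identified ob C \<phi> \<longleftrightarrow>
     (\<forall>S\<in>C. \<forall>S'\<in>C. (\<forall>x\<in>supp_x ob. p0 S x = p0 S' x) \<longrightarrow> \<phi> S = \<phi> S')"

end

theory Submission
  imports Defs "HOL-Complex_Analysis.Complex_Analysis"
begin

text \<open>
  The law of \<open>v\<close> given \<open>x\<close> has mean \<open>beta0 w + beta1 w * d\<close>, so two values of \<open>d\<close> determine the
  coefficients and, after a shift, the law of \<open>e\<close>.  Completeness applied to the difference of the
  two formulas for \<open>p0\<close> shows that the distribution functions of \<open>\<epsilon>\<close> given \<open>w\<close> agree at almost all
  points \<open>- v z\<close>.  These points are dense: either \<open>e\<close> is unbounded, or its exponential moment has a
  complex zero, and then completeness keeps the values of \<open>v\<close> given \<open>z\<close> from having long gaps in one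
  direction; letting \<open>z\<close> tend to \<open>0\<close> along the neighbourhood of \<open>(d*, 0)\<close> fills the whole space.
  Finally the moments of \<open>\<epsilon>\<close> given \<open>w\<close> are polynomials in \<open>w\<close> that are known on a dense subset of a
  ball, and their coefficients are multiples of the moments of \<open>(\<theta>, \<zeta>)\<close>.
\<close>

section \<open>Supports and independence\<close>

text \<open>Completeness at (z, w) controls only values of v that occur together with that z,
  whereas \<open>supp_v\<close> pools over all z: a pair taken from the product of the two supports
  may lie where nothing is known. The points - v z are therefore built with v from the law given the
  same z. This yields a dense set, and density is enough because distribution functions are
  continuous from the upper right.

  For fixed w the laws of v are translates of the law of e. If the exponential moment of e vanishes
  at z, every translate integrates exp (z t) to 0. This function need not be bounded, but a wide
  enough gap in the translation parameters leaves room to truncate it without disturbing any of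
  these integrals.

  Independence of (\<theta>, \<zeta>) and w concerns their joint law, so the conditional law of the
  coefficients is constant only for almost every w. This is why moments are compared on a dense part
  of a ball.\<close>

lemma AE_msupport:
  fixes M :: "'a::second_countable_topology measure"
  assumes M: "sets M = sets borel"
  shows "AE x in M. x \<in> msupport M"
proof -
  \<comment> \<open>Countability of the basis makes the union of all null basic open sets
    null.\<close>
  obtain B :: "'a set set" where B: "countable B" "topological_basis B"
    using ex_countable_basis by blast
  define N where "N = \<Union>{U \<in> B. emeasure M U = 0}"
  have "U \<in> null_sets M" if "U \<in> B" "emeasure M U = 0" for U
    using that topological_basis_open[OF B(2)] M by (auto simp: null_sets_def)
  then have "N \<in> null_sets M"
    unfolding N_def using B(1) null_sets_UN'[of "{U \<in> B. emeasure M U = 0}" id M]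
    by (auto intro: countable_subset)
  moreover have "x \<in> N" if "x \<notin> msupport M" for x
  proof -
    obtain U where U: "open U" "x \<in> U" "emeasure M U = 0"
      using \<open>x \<notin> msupport M\<close> by (auto simp: msupport_def not_gr_zero)
    obtain V where V: "V \<in> B" "x \<in> V" "V \<subseteq> U"
      using topological_basisE[OF B(2) U(1,2)] by blast
    have "emeasure M V \<le> emeasure M U"
      using U(1) V(3) M by (intro emeasure_mono) auto
    then show ?thesis
      using U(3) V by (auto simp: N_def)
  qed
  ultimately show ?thesis
    by (intro AE_I'[of N]) auto
qed

text \<open>\<open>indep_rv\<close> speaks of preimages, while Fubini arguments use the product
  form. Rectangles determine a product of sigma-finite measures.\<close>

lemma distr_indep_rv:
  fixes X :: "'a \<Rightarrow> 'b::second_countable_topology" and Y :: "'a \<Rightarrow> 'c::second_countable_topology"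
  assumes "prob_space M" and "indep_rv M X Y"
  shows "distr M borel (\<lambda>x. (X x, Y x)) = distr M borel X \<Otimes>\<^sub>M distr M borel Y"
proof -
  interpret prob_space M by fact
  have [measurable]: "X \<in> borel_measurable M" "Y \<in> borel_measurable M"
    and ind: "indep_set {X -` A \<inter> space M | A. A \<in> sets borel} {Y -` B \<inter> space M | B. B \<in> sets borel}"
    using \<open>indep_rv M X Y\<close> by (auto simp: indep_rv_def)
  interpret X: prob_space "distr M borel X" by (rule prob_space_distr) simp
  interpret Y: prob_space "distr M borel Y" by (rule prob_space_distr) simp
  show ?thesis
  proof (rule pair_measure_eqI[symmetric])
    show "sets (distr M borel X \<Otimes>\<^sub>M distr M borel Y) = sets (distr M borel (\<lambda>x. (X x, Y x)))"
      by (simp add: borel_prod[symmetric] cong: sets_pair_measure_cong)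
    fix A B assume "A \<in> sets (distr M borel X)" "B \<in> sets (distr M borel Y)"
    then have [measurable]: "A \<in> sets borel" "B \<in> sets borel" by auto
    have "emeasure (distr M borel (\<lambda>x. (X x, Y x))) (A \<times> B)
        = emeasure M ((X -` A \<inter> space M) \<inter> (Y -` B \<inter> space M))"
      by (subst emeasure_distr) (auto simp: borel_prod[symmetric] intro!: arg_cong[where f = "emeasure M"])
    also have "\<dots> = emeasure M (X -` A \<inter> space M) * emeasure M (Y -` B \<inter> space M)"
    proof -
      have "prob ((X -` A \<inter> space M) \<inter> (Y -` B \<inter> space M)) = prob (X -` A \<inter> space M) * prob (Y -` B \<inter> space M)"
        by (intro indep_setD[OF ind]) auto
      then show ?thesis by (simp add: emeasure_eq_measure ennreal_mult'')
    qed
    finally show "emeasure (distr M borel X) A * emeasure (distr M borel Y) B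
        = emeasure (distr M borel (\<lambda>x. (X x, Y x))) (A \<times> B)"
      by (simp add: emeasure_distr)
  qed unfold_locales
qed

text \<open>An event on Y is an event on (Y, Z) through the cylinder \<open>B \<times> UNIV\<close>,
  so a smaller family of events has to factorize.\<close>

lemma indep_rv_fst:
  fixes X :: "'a \<Rightarrow> 'b::second_countable_topology" and Y :: "'a \<Rightarrow> 'c::second_countable_topology"
    and Z :: "'a \<Rightarrow> 'd::second_countable_topology"
  assumes "prob_space M" and "indep_rv M X (\<lambda>x. (Y x, Z x))"
  shows "indep_rv M X Y"
proof -
  interpret prob_space M by fact
  have X[measurable]: "X \<in> borel_measurable M" and YZ: "(\<lambda>x. (Y x, Z x)) \<in> borel_measurable M"
    and ind: "indep_set {X -` A \<inter> space M | A. A \<in> sets borel}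
      {(\<lambda>x. (Y x, Z x)) -` B \<inter> space M | B. B \<in> sets borel}"
    using assms(2) by (auto simp: indep_rv_def)
  from YZ have "(\<lambda>x. fst (Y x, Z x)) \<in> borel_measurable M"
    unfolding borel_prod[symmetric] by measurable
  then have Y: "Y \<in> borel_measurable M" by simp
  have "indep_set {X -` A \<inter> space M | A. A \<in> sets borel} {Y -` B \<inter> space M | B. B \<in> sets borel}"
    unfolding indep_set_def
  proof (rule indep_sets_mono_sets[OF ind[unfolded indep_set_def]])
    fix i :: bool
    have "B \<times> UNIV \<in> sets (borel :: ('c \<times> 'd) measure)" if "B \<in> sets borel" for B
      unfolding borel_prod[symmetric] using that by auto
    then have "\<exists>B'. Y -` B \<inter> space M = (\<lambda>x. (Y x, Z x)) -` B' \<inter> space M \<and> B' \<in> sets borel"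
      if "B \<in> sets borel" for B
      using that by (intro exI[of _ "B \<times> UNIV"]) auto
    then show "case_bool {X -` A \<inter> space M | A. A \<in> sets borel} {Y -` B \<inter> space M | B. B \<in> sets borel} i
       \<subseteq> case_bool {X -` A \<inter> space M | A. A \<in> sets borel}
           {(\<lambda>x. (Y x, Z x)) -` B \<inter> space M | B. B \<in> sets borel} i"
      by (cases i) auto
  qed
  with X Y show ?thesis by (simp add: indep_rv_def)
qed

lemma indep_rv_commute:
  assumes "prob_space M" and "indep_rv M X Y"
  shows "indep_rv M Y X"
proof -
  interpret prob_space M by fact
  have "indep_set B A" if "indep_set A B" for A B
  proof -
    have AB: "A \<subseteq> events" "B \<subseteq> events" "\<And>a b. a \<in> A \<Longrightarrow> b \<in> B \<Longrightarrow> prob (a \<inter> b) = prob a * prob b"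
      using that by (auto simp only: indep_sets2_eq)
    then have "prob (b \<inter> a) = prob b * prob a" if "a \<in> A" "b \<in> B" for a b
      using AB(3)[OF that] by (simp only: Int_commute mult.commute)
    with AB(1,2) show ?thesis by (auto simp only: indep_sets2_eq)
  qed
  then show ?thesis
    using assms(2) by (simp add: indep_rv_def)
qed

section \<open>Zeros of exponential moments and bounded completeness\<close>

text \<open>By the Schwarz lemma applied to \<open>f / (2 K - f)\<close>, as in the Borel--Caratheodory theorem.\<close>

lemma entire_linear_Re_bound:
  assumes h: "h holomorphic_on UNIV" and b: "0 \<le> b" and Re_le: "\<And>z. Re (h z) \<le> b * norm z"
  shows "\<exists>a c. \<forall>z. h z = a + c * z"
proof -
  have bound: "norm (h z) \<le> 3 * norm (h 0) + 2 * (b * (2 * norm z + 1) + 1)" for z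
  proof -
    \<comment> \<open>Doubling the norm puts z / R in the disc of radius 1/2. There the Schwarz
      bound reads |f| \<le> |2 K - f| / 2, which solves to |f| \<le> 2 K.\<close>
    define R where "R = 2 * norm z + 1"
    define K where "K = b * R + norm (h 0) + 1"
    define f where "f w = h (of_real R * w) - h 0" for w :: complex
    have R: "R > 0" and K: "K > 0"
      using b by (auto simp: R_def K_def intro!: add_nonneg_pos)
    have Re_f: "Re (f w) < K" if "norm w < 1" for w
    proof -
      have "Re (f w) \<le> b * (R * norm w) + norm (h 0)"
        using Re_le[of "of_real R * w"] R abs_Re_le_cmod[of "h 0"] by (simp add: f_def norm_mult)
      moreover have "b * (R * norm w) \<le> b * R"
        using b R that by (intro mult_left_mono) (auto intro: mult_left_le)
      ultimately show ?thesis by (simp add: K_def)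
    qed
    have nz: "2 * K - f w \<noteq> 0" if "norm w < 1" for w
    proof -
      have "Re (complex_of_real (2 * K) - f w) > 0" using Re_f[OF that] K by simp
      then show ?thesis by (metis less_irrefl zero_complex.sel(1))
    qed
    define \<phi> where "\<phi> w = f w / (2 * K - f w)" for w
    have holf: "f holomorphic_on A" for A
      unfolding f_def by (intro holomorphic_intros holomorphic_on_compose_gen[OF _ h, unfolded o_def]) auto
    have norm_\<phi>: "norm (\<phi> w) < 1" if "norm w < 1" for w
    proof -
      have "(norm (f w))\<^sup>2 < (norm (2 * K - f w))\<^sup>2"
      proof -
        \<comment> \<open>The identity behind the form of \<open>\<phi>\<close>: u / (2 K - u) maps
          the half-plane Re u < K into the unit disc.\<close>
        have "0 < 4 * K * (K - Re (f w))" using K Re_f[OF that] by simp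
        also have "\<dots> = (norm (2 * K - f w))\<^sup>2 - (norm (f w))\<^sup>2"
          unfolding cmod_power2 by (simp add: power2_eq_square algebra_simps)
        finally show ?thesis by simp
      qed
      then have "norm (f w) < norm (2 * K - f w)"
        by (rule power2_less_imp_less) simp
      then show ?thesis using nz[OF that] by (simp add: \<phi>_def norm_divide)
    qed
    have "norm (z / R) = norm z / R" using R by (simp add: norm_divide)
    also have "\<dots> < 1/2" using R by (subst pos_divide_less_eq) (auto simp: R_def)
    finally have zR: "norm (z / R) < 1/2" "norm (z / R) < 1" by simp_all
    have "norm (\<phi> (z / R)) \<le> norm (z / R)"
    proof (rule Schwarz_Lemma(1)[of \<phi>])
      show "\<phi> holomorphic_on ball 0 1"
        unfolding \<phi>_def using nz by (intro holomorphic_intros holf) auto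
      show "\<phi> 0 = 0" by (simp add: \<phi>_def f_def)
      show "norm (z / R) < 1" by (rule zR)
    qed (rule norm_\<phi>)
    with zR have "norm (\<phi> (z / R)) \<le> 1/2" by linarith
    moreover have "norm (f (z / R)) = norm (\<phi> (z / R)) * norm (2 * K - f (z / R))"
      using nz[OF zR(2)] by (simp add: \<phi>_def norm_divide)
    ultimately have "norm (f (z / R)) \<le> 1/2 * norm (2 * K - f (z / R))"
      by (metis mult_right_mono norm_ge_zero)
    also have "\<dots> \<le> 1/2 * (2 * K + norm (f (z / R)))"
      using norm_triangle_ineq4[of "2 * K" "f (z/R)"] K by simp
    finally have "norm (f (z / R)) \<le> 2 * K" by simp
    then have "norm (h z - h 0) \<le> 2 * K" using R by (simp add: f_def)
    then show ?thesis
      using norm_triangle_ineq2[of "h z" "h 0"] by (simp add: K_def R_def algebra_simps)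
  qed
  \<comment> \<open>For norm z at least 1 the constant terms of \<open>bound\<close> are absorbed
    into multiples of norm z, and 2 * norm z + 1 into 3 * norm z.\<close>
  define B where "B = 3 * norm (h 0) + 2 * (b * 3 + 1)"
  have lin: "norm (h z) \<le> B * norm z ^ 1" if "1 \<le> norm z" for z
  proof -
    have "3 * norm (h 0) \<le> 3 * norm (h 0) * norm z"
      using that mult_left_mono[of 1 "norm z" "norm (h 0)"] by simp
    moreover have "b * (2 * norm z + 1) \<le> b * (3 * norm z)"
      using that b by (intro mult_left_mono) auto
    ultimately show ?thesis using bound[of z] that by (simp add: B_def algebra_simps)
  qed
  have "h z = h 0 + deriv h 0 * z" for z
    using Liouville_polynomial[OF h lin, where \<xi> = z] by simp
  then show ?thesis by blast
qed

text \<open>Boundedness of e dominates the terms by the exponential series at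
  \<open>norm z * \<bar>b\<bar>\<close>, so sum and integral commute. The power series converges
  everywhere, which makes the exponential moment entire.\<close>

lemma exp_moment_sums:
  fixes Q :: "real measure" and z :: complex
  assumes "prob_space Q" and Q: "sets Q = sets borel" and bnd: "AE e in Q. \<bar>e\<bar> \<le> b"
  shows "(\<lambda>n. (LINT e|Q. complex_of_real e ^ n / fact n) * z ^ n) sums (LINT e|Q. exp (z * e))"
proof -
  interpret prob_space Q by fact
  have [measurable_cong]: "sets Q = sets borel" by fact
  define f where "f n e = (z * complex_of_real e) ^ n / fact n" for n e
  have le: "norm (f n e) \<le> (norm z * \<bar>b\<bar>) ^ n / fact n" if "\<bar>e\<bar> \<le> b" for n e
  proof -
    have "norm (f n e) = (norm z * \<bar>e\<bar>) ^ n / fact n"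
      by (simp add: f_def norm_mult norm_divide norm_power)
    also have "\<dots> \<le> (norm z * \<bar>b\<bar>) ^ n / fact n"
      using that by (intro divide_right_mono power_mono mult_left_mono) auto
    finally show ?thesis .
  qed
  have [measurable]: "f n \<in> borel_measurable Q" for n unfolding f_def by measurable
  have int: "integrable Q (f n)" for n
    using bnd by (intro integrable_const_bound[where B = "(norm z * \<bar>b\<bar>) ^ n / fact n"])
      (auto intro: le)
  have summ: "summable (\<lambda>n. (norm z * \<bar>b\<bar>) ^ n / fact n)"
    using summable_exp_generic[of "norm z * \<bar>b\<bar>"] by (simp add: divide_inverse mult.commute)
  have "(\<lambda>n. integral\<^sup>L Q (f n)) sums (LINT e|Q. (\<Sum>n. f n e))"
  proof (rule sums_integral[OF int])
    show "AE e in Q. summable (\<lambda>n. norm (f n e))"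
      using bnd
    proof eventually_elim
      case (elim e)
      then show ?case
        using le[OF elim] by (intro summable_comparison_test'[OF summ, of 0])
          (metis abs_norm_cancel real_norm_def)
    qed
    have "(LINT e|Q. norm (f n e)) \<le> (LINT e|Q. (norm z * \<bar>b\<bar>) ^ n / fact n)" for n
      using bnd by (intro integral_mono_AE integrable_norm int) (auto intro: le)
    then show "summable (\<lambda>n. LINT e|Q. norm (f n e))"
      by (intro summable_comparison_test'[OF summ, of 0]) (simp add: prob_space)
  qed
  also have "(\<lambda>e. \<Sum>n. f n e) = (\<lambda>e. exp (z * e))"
    by (simp add: f_def exp_def scaleR_conv_of_real divide_inverse mult.commute)
  also have "(\<lambda>n. integral\<^sup>L Q (f n)) = (\<lambda>n. (LINT e|Q. complex_of_real e ^ n / fact n) * z ^ n)"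
    unfolding f_def integral_mult_left_zero[symmetric]
    by (simp add: power_mult_distrib field_simps)
  finally show ?thesis .
qed

text \<open>
  Otherwise its logarithm is entire with real part of linear growth, hence affine, so the values at
  \<open>1\<close> and \<open>-1\<close> have product \<open>1\<close>; both are at least \<open>1\<close>, with equality only if \<open>e = 0\<close>.
\<close>

lemma exp_moment_has_zero:
  fixes Q :: "real measure"
  assumes "prob_space Q" and Q: "sets Q = sets borel" and bnd: "AE e in Q. \<bar>e\<bar> \<le> b"
    and mean: "(LINT e|Q. e) = 0" and nondeg: "\<not> (AE e in Q. e = 0)"
  shows "\<exists>z. (LINT e|Q. exp (z * complex_of_real e)) = 0"
proof (rule ccontr)
  assume *: "\<nexists>z. (LINT e|Q. exp (z * complex_of_real e)) = 0"
  interpret prob_space Q by fact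
  have [measurable_cong]: "sets Q = sets borel" by fact
  define M where "M z = (LINT e|Q. exp (z * complex_of_real e))" for z
  have bnd': "AE e in Q. \<bar>e\<bar> \<le> \<bar>b\<bar>" using bnd by eventually_elim simp
  have "M holomorphic_on ball 0 r" for r
    using exp_moment_sums[OF assms(1-3)] unfolding M_def
    by (intro power_series_holomorphic[where a = "\<lambda>n. (LINT e|Q. complex_of_real e ^ n / fact n)"]) simp
  then have "M field_differentiable at z" for z
    using holomorphic_on_imp_differentiable_at[of M "ball 0 (norm z + 1)" z] by simp
  then have holM: "M holomorphic_on UNIV"
    by (simp add: holomorphic_on_def)
  obtain h where h: "h holomorphic_on UNIV" "\<And>z. M z = exp (h z)"
    using holomorphic_logarithm_exists[OF convex_UNIV open_UNIV holM, of 0] * unfolding M_def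
    by (metis UNIV_I)
  have "Re (h z) \<le> \<bar>b\<bar> * norm z" for z
  proof -
    have le: "AE e in Q. norm (exp (z * complex_of_real e)) \<le> exp (\<bar>b\<bar> * norm z)"
      using bnd'
    proof eventually_elim
      case (elim e)
      have "Re z * e \<le> \<bar>Re z\<bar> * \<bar>e\<bar>"
        by (metis abs_ge_self abs_mult)
      also have "\<dots> \<le> norm z * \<bar>b\<bar>"
        using elim abs_Re_le_cmod[of z] by (intro mult_mono) auto
      finally have "Re z * e \<le> norm z * \<bar>b\<bar>" .
      then show ?case by (simp add: mult.commute)
    qed
    have "exp (Re (h z)) = norm (M z)" using h(2) by simp
    also have "\<dots> \<le> (LINT e|Q. norm (exp (z * complex_of_real e)))"
      unfolding M_def by (rule integral_norm_bound)
    also have "\<dots> \<le> (LINT e|Q. exp (\<bar>b\<bar> * norm z))"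
      using le by (intro integral_mono_AE integrable_const_bound[where B = "exp (\<bar>b\<bar> * norm z)"]) auto
    finally show ?thesis by (simp add: prob_space)
  qed
  then obtain a c where hz: "\<And>z. h z = a + c * z"
    using entire_linear_Re_bound[OF h(1), of "\<bar>b\<bar>"] by auto
  have "M 0 = 1" by (simp add: M_def prob_space)
  then have "M 1 * M (-1) = 1"
    using h(2)[of 0] by (simp add: h(2) hz exp_add exp_diff)
  moreover define m where "m s = (LINT e|Q. exp (s * e))" for s :: real
  have M_m: "M (of_real s) = of_real (m s)" for s
    unfolding M_def m_def integral_complex_of_real[symmetric] by (simp add: exp_of_real[symmetric])
  ultimately have m1: "m 1 * m (-1) = 1"
    using M_m[of 1] M_m[of "-1"] by (simp flip: of_real_mult)
  have int_e: "integrable Q (\<lambda>e. e)"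
    using bnd' by (intro integrable_const_bound[where B = "\<bar>b\<bar>"]) auto
  have int_m: "integrable Q (\<lambda>e. exp (s * e))" for s :: real
    using bnd'
  proof (intro integrable_const_bound[where B = "exp (\<bar>s\<bar> * \<bar>b\<bar>)"])
    show "AE e in Q. norm (exp (s * e)) \<le> exp (\<bar>s\<bar> * \<bar>b\<bar>)"
      using bnd'
    proof eventually_elim
      case (elim e)
      have "s * e \<le> \<bar>s\<bar> * \<bar>e\<bar>"
        by (metis abs_ge_self abs_mult)
      also have "\<dots> \<le> \<bar>s\<bar> * \<bar>b\<bar>"
        using elim by (intro mult_left_mono) auto
      finally have "s * e \<le> \<bar>s\<bar> * \<bar>b\<bar>" .
      then show ?case by simp
    qed
  qed simp
  \<comment> \<open>The integrand is nonnegative, and its integral is m s - 1 because e has mean 0.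
    Thus m s \<ge> 1, and m 1 = 1 forces the integrand to vanish almost everywhere.\<close>
  have int_d: "(LINT e|Q. exp (s * e) - 1 - s * e) = m s - 1" for s :: real
    using int_e int_m[of s] mean by (simp add: m_def prob_space)
  have pos: "0 \<le> (LINT e|Q. exp (s * e) - 1 - s * e)" for s :: real
    using exp_ge_add_one_self by (intro integral_nonneg_AE AE_I2) (simp add: algebra_simps)
  have m_ge: "1 \<le> m s" for s using int_d[of s] pos[of s] by linarith
  have "m 1 \<le> m 1 * m (-1)" using m_ge[of 1] m_ge[of "-1"] by simp
  then have "m 1 = 1" using m1 m_ge[of 1] by simp
  then have "(LINT e|Q. exp (1 * e) - 1 - 1 * e) = 0" using int_d[of 1] by simp
  moreover have "integrable Q (\<lambda>e. exp (1 * e) - 1 - 1 * e)"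
    using int_e int_m[of 1] by auto
  ultimately have "AE e in Q. exp (1 * e) - 1 - 1 * e = 0"
    using exp_ge_add_one_self
    by (subst (asm) integral_nonneg_eq_0_iff_AE) (auto simp: algebra_simps)
  then have "AE e in Q. e = 0"
  proof eventually_elim
    case (elim e)
    then have "exp e = 1 + e" by simp
    \<comment> \<open>This makes 1 + e / 2 positive, so exp (e / 2) \<ge> 1 + e / 2 may be squared;
      comparison with exp e = 1 + e leaves no room for a nonzero square of e.\<close>
    then have "1 + e > 0" using exp_gt_zero[of e] by linarith
    then have "(1 + e / 2)\<^sup>2 \<le> (exp (e / 2))\<^sup>2"
      using exp_ge_add_one_self[of "e / 2"] by (intro power_mono) auto
    also have "(exp (e / 2))\<^sup>2 = 1 + e"
      using elim by (simp add: exp_double[symmetric])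
    finally have "e\<^sup>2 \<le> 0" by (simp add: power2_eq_square algebra_simps)
    then show ?case by simp
  qed
  with nondeg show False ..
qed

text \<open>
  A zero \<open>z\<close> of the exponential moment of \<open>e\<close> makes \<open>exp (z t)\<close>, cut off at a gap of \<open>V\<close> on the side
  where it is unbounded, a counterexample to bounded completeness.
\<close>

lemma boundedly_complete_no_gap:
  fixes Q :: "real measure" and z :: complex and \<sigma> :: real
  assumes "prob_space Q" and Q: "sets Q = sets borel" and bnd: "AE e in Q. \<bar>e\<bar> \<le> b"
    and zero: "(LINT e|Q. exp (z * complex_of_real e)) = 0"
    and compl: "boundedly_complete {distr Q borel (\<lambda>e. v + e) | v. v \<in> V}"
    and \<sigma>: "\<bar>\<sigma>\<bar> = 1" "\<sigma> * Re z \<le> 0" and v0: "v0 \<in> V" "\<sigma> * T \<le> \<sigma> * v0"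
  shows "\<exists>v\<in>V. \<bar>v - T\<bar> \<le> 2 * b"
proof (rule ccontr)
  assume neg: "\<not> ?thesis"
  interpret prob_space Q by fact
  have [measurable_cong]: "sets Q = sets borel" by fact
  have "\<not> (AE e in Q. False)" by simp
  then have b: "b \<ge> 0"
    using bnd by (metis (mono_tags, lifting) abs_ge_zero eventually_mono order_trans)
  have bnd\<sigma>: "AE e in Q. \<bar>\<sigma> * e\<bar> \<le> b"
    using bnd \<sigma>(1) by (simp add: abs_mult)
  have gap: "\<sigma> * v < \<sigma> * T - 2 * b \<or> \<sigma> * T < \<sigma> * v" if "v \<in> V" for v
  proof -
    have "2 * b < \<bar>v - T\<bar>" using neg that by force
    also have "\<bar>v - T\<bar> = \<bar>\<sigma> * v - \<sigma> * T\<bar>"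
      using \<sigma>(1) by (metis abs_mult mult_1 right_diff_distrib)
    finally show ?thesis using b by linarith
  qed
  have int: "integrable Q (\<lambda>e. exp (z * complex_of_real e))"
  proof (rule integrable_const_bound)
    show "AE e in Q. norm (exp (z * complex_of_real e)) \<le> exp (\<bar>Re z\<bar> * b)"
      using bnd
    proof eventually_elim
      case (elim e)
      have "Re z * e \<le> \<bar>Re z\<bar> * \<bar>e\<bar>" by (metis abs_ge_self abs_mult)
      also have "\<dots> \<le> \<bar>Re z\<bar> * b" using elim by (intro mult_left_mono) auto
      finally show ?case by simp
    qed
  qed simp
  \<comment> \<open>The cut at \<sigma> T - b is at distance b from both \<sigma> T - 2 b and
    \<sigma> T, so no translate of e straddles it: its mass lies wholly where g is 0 or wholly where
    g is the exponential. \<open>P\<close> will be \<open>Re\<close> or \<open>Im\<close>, since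
    \<open>boundedly_complete\<close> tests real functions.\<close>
  define g where "g P t = (if \<sigma> * t > \<sigma> * T - b then P (exp (z * complex_of_real t)) else 0)"
    for P :: "complex \<Rightarrow> real" and t
  have g0: "AE t in distr Q borel (\<lambda>e. v0 + e). g P t = 0"
    if P: "bounded_linear P" and P_le: "\<And>u. \<bar>P u\<bar> \<le> norm u" for P
  proof -
    have [measurable]: "P \<in> borel_measurable borel"
      using P by (intro borel_measurable_continuous_onI linear_continuous_on)
    have g[measurable]: "g P \<in> borel_measurable borel"
      unfolding g_def by measurable
    \<comment> \<open>On the side that is kept, \<sigma> * Re z \<le> 0 makes the modulus
      nonincreasing in \<sigma> * t, so its value at the cut is a bound.\<close>
    have "\<bar>g P t\<bar> \<le> exp (\<sigma> * Re z * (\<sigma> * T - b))" for t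
    proof (cases "\<sigma> * t > \<sigma> * T - b")
      case True
      have "\<bar>g P t\<bar> \<le> norm (exp (z * complex_of_real t))"
        using True P_le[of "exp (z * complex_of_real t)"] by (simp add: g_def del: norm_exp_eq_Re)
      also have "\<dots> = exp (\<sigma> * Re z * (\<sigma> * t))"
      proof -
        have "\<sigma> * \<sigma> = 1" using \<sigma>(1) abs_mult_self_eq[of \<sigma>] by simp
        moreover have "\<sigma> * Re z * (\<sigma> * t) = (\<sigma> * \<sigma>) * (Re z * t)" by (simp only: ac_simps)
        ultimately show ?thesis by simp
      qed
      also have "\<dots> \<le> exp (\<sigma> * Re z * (\<sigma> * T - b))"
        using True \<sigma>(2) by (simp only: exp_le_cancel_iff) (intro mult_left_mono_neg, auto)
      finally show ?thesis .
    qed (simp add: g_def)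
    then have "bounded (range (g P))"
      by (auto simp: bounded_iff)
    moreover have "(LINT t|N. g P t) = 0"
      if N_in: "N \<in> {distr Q borel (\<lambda>e. v + e) | v. v \<in> V}" for N
    proof -
      obtain v where v: "v \<in> V" "N = distr Q borel (\<lambda>e. v + e)"
        using N_in by blast
      have N: "(LINT t|N. g P t) = (LINT e|Q. g P (v + e))"
        unfolding v(2) by (rule integral_distr) auto
      show ?thesis
        using gap[OF v(1)]
      proof
        assume "\<sigma> * v < \<sigma> * T - 2 * b"
        then have "AE e in Q. g P (v + e) = 0"
          using bnd\<sigma> by (auto simp: g_def algebra_simps elim!: eventually_mono)
        then show ?thesis unfolding N by (rule integral_eq_zero_AE)
      next
        assume *: "\<sigma> * T < \<sigma> * v"
        have "AE e in Q. g P (v + e) = P (exp (z * v) * exp (z * complex_of_real e))"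
          using bnd\<sigma>
        proof eventually_elim
          case (elim e)
          then have "\<sigma> * (v + e) > \<sigma> * T - b" using * by (simp add: algebra_simps)
          then show ?case by (simp add: g_def exp_add[symmetric] algebra_simps)
        qed
        then have "(LINT e|Q. g P (v + e)) = (LINT e|Q. P (exp (z * v) * exp (z * complex_of_real e)))"
          by (intro integral_cong_AE) auto
        also have "\<dots> = P (LINT e|Q. exp (z * v) * exp (z * complex_of_real e))"
          using int by (intro integral_bounded_linear[OF P]) auto
        also have "\<dots> = 0"
          using zero P by (simp add: linear_0 bounded_linear.linear)
        finally show ?thesis unfolding N .
      qed
    qed
    ultimately show ?thesis
      using compl g v0(1) unfolding boundedly_complete_def by blast
  qed
  \<comment> \<open>\<open>v0\<close> lies beyond the gap, so real and imaginary part of exp (z t)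
    would both vanish almost everywhere under its law, although exp has no zero.\<close>
  have "\<sigma> * T < \<sigma> * v0" using gap[OF v0(1)] v0(2) b by auto
  have "AE e in Q. g Re (v0 + e) = 0" "AE e in Q. g Im (v0 + e) = 0"
    using g0[of Re] g0[of Im] bounded_linear_Re bounded_linear_Im abs_Re_le_cmod abs_Im_le_cmod
    by (auto simp: AE_distr_iff g_def)
  then have "AE e in Q. False"
    using bnd\<sigma>
  proof eventually_elim
    case (elim e)
    have "\<sigma> * (v0 + e) > \<sigma> * T - b"
      using elim(3) \<open>\<sigma> * T < \<sigma> * v0\<close> by (simp add: algebra_simps)
    then have "exp (z * complex_of_real (v0 + e)) = 0"
      using elim(1,2) by (intro complex_eqI) (simp_all only: g_def if_True zero_complex.sel)
    then show False by simp
  qed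
  then show False by simp
qed

section \<open>Dense sets of evaluation points\<close>

text \<open>The factor t is located only within C of a far target \<tau>, but relative to \<tau>
  this error becomes negligible: for z close to - r / \<tau> the vector - t z is close to (t /
  \<tau>) r. The order of quantifiers matters, as \<tau> must be known before z is placed near - r /
  \<tau>.\<close>

lemma dense_scaled_vectors:
  fixes Z :: "'a::real_normed_vector set" and V :: "'a \<Rightarrow> real set"
  assumes far: "\<And>n::real. \<exists>\<tau>. n \<le> \<bar>\<tau>\<bar> \<and> (\<forall>z\<in>Z. \<exists>t\<in>V z. \<bar>t - \<tau>\<bar> \<le> C)"
    and near: "\<And>z0 \<delta>. norm z0 < \<eta> \<Longrightarrow> \<delta> > 0 \<Longrightarrow> \<exists>z\<in>Z. norm (z - z0) < \<delta>"
    and "\<eta> > 0" "\<epsilon> > 0"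
  shows "\<exists>z\<in>Z. \<exists>t\<in>V z. norm (- (t *\<^sub>R z) - r) < \<epsilon>"
proof -
  obtain z1 where z1: "z1 \<in> Z" using near[of 0 1] \<open>\<eta> > 0\<close> by auto
  obtain \<tau>1 t1 where "\<bar>t1 - \<tau>1\<bar> \<le> C" using far[of 0] z1 by blast
  then have C: "C \<ge> 0" by linarith
  \<comment> \<open>The summands ensure in turn that \<tau> is nonzero, that - r / \<tau> lies in
    the ball of radius \<eta>, and that a relative error of C / |\<tau>| moves r by less than
    \<epsilon> / 2.\<close>
  define n where "n = 1 + norm r / \<eta> + 2 * C * norm r / \<epsilon>"
  obtain \<tau> where \<tau>: "n \<le> \<bar>\<tau>\<bar>" "\<And>z. z \<in> Z \<Longrightarrow> \<exists>t\<in>V z. \<bar>t - \<tau>\<bar> \<le> C"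
    using far[of n] by blast
  have "norm r / \<eta> \<ge> 0" "2 * C * norm r / \<epsilon> \<ge> 0" using C assms(3,4) by auto
  then have \<tau>': "\<bar>\<tau>\<bar> > norm r / \<eta>" "\<bar>\<tau>\<bar> > 2 * C * norm r / \<epsilon>" "\<bar>\<tau>\<bar> \<ge> 1"
    using \<tau>(1) unfolding n_def by linarith+
  define z0 where "z0 = - (1 / \<tau>) *\<^sub>R r"
  have "norm z0 < \<eta>"
    using \<tau>'(1,3) \<open>\<eta> > 0\<close> by (simp add: z0_def field_simps)
  then obtain z where z: "z \<in> Z" "norm (z - z0) < \<epsilon> / (2 * (\<bar>\<tau>\<bar> + C))"
    using near[of z0 "\<epsilon> / (2 * (\<bar>\<tau>\<bar> + C))"] \<tau>'(3) C \<open>\<epsilon> > 0\<close> by force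
  obtain t where t: "t \<in> V z" "\<bar>t - \<tau>\<bar> \<le> C" using \<tau>(2)[OF z(1)] by blast
  \<comment> \<open>The two errors are the displacement of z, magnified by |t| \<le> |\<tau>| + C,
    and the displacement of t from \<tau>.\<close>
  have "- (t *\<^sub>R z) - r = - (t *\<^sub>R (z - z0)) + ((t - \<tau>) / \<tau>) *\<^sub>R r"
    using \<tau>'(3) by (auto simp: z0_def algebra_simps diff_divide_distrib)
  then have "norm (- (t *\<^sub>R z) - r) \<le> \<bar>t\<bar> * norm (z - z0) + \<bar>t - \<tau>\<bar> / \<bar>\<tau>\<bar> * norm r"
    using norm_triangle_ineq[of "- (t *\<^sub>R (z - z0))" "((t - \<tau>) / \<tau>) *\<^sub>R r"]
    by (simp add: abs_divide)
  also have "\<bar>t\<bar> * norm (z - z0) \<le> (\<bar>\<tau>\<bar> + C) * norm (z - z0)"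
    using t(2) by (intro mult_right_mono) auto
  also have "\<dots> < \<epsilon> / 2"
    using z(2) \<tau>'(3) C by (simp add: field_simps)
  also have "\<bar>t - \<tau>\<bar> / \<bar>\<tau>\<bar> * norm r \<le> C / \<bar>\<tau>\<bar> * norm r"
    using t(2) by (intro mult_right_mono divide_right_mono) auto
  also have "\<dots> < \<epsilon> / 2"
    using \<tau>'(2,3) \<open>\<epsilon> > 0\<close> by (simp add: field_simps)
  finally show ?thesis using z(1) t(1) by auto
qed

text \<open>Any point is the limit of points of the dense set that decrease to it in every
  coordinate, and along such sequences distribution functions converge.\<close>

lemma measure_eqI_dense_cdf:
  fixes M N :: "(real ^ 'j::finite) measure"
  assumes "finite_measure M" "finite_measure N" and M: "sets M = sets borel" and N: "sets N = sets borel"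
    and dense: "\<And>U. open U \<Longrightarrow> U \<noteq> {} \<Longrightarrow> \<exists>x\<in>U. measure M {..x} = measure N {..x}"
  shows "M = N"
proof -
  interpret M: finite_measure M by fact
  interpret N: finite_measure N by fact
  have eq: "measure M {..a} = measure N {..a}" for a
  proof -
    \<comment> \<open>The open boxes between consecutive corners are stacked towards
      \<open>a\<close>. One point from each box gives a sequence decreasing in every coordinate and
      strictly above \<open>a\<close>, whatever the choice.\<close>
    define c :: "nat \<Rightarrow> real ^ 'j" where "c n = a + (\<chi> i. 1 / real (Suc n))" for n
    have "\<exists>x. x \<in> box (c (Suc n)) (c n) \<and> measure M {..x} = measure N {..x}" for n
      using dense[of "box (c (Suc n)) (c n)"]
      by (auto simp: open_box box_ne_empty Basis_vec_def inner_axis c_def field_simps)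
    then obtain x where x: "\<And>n. x n \<in> box (c (Suc n)) (c n)"
        "\<And>n. measure M {..x n} = measure N {..x n}"
      by metis
    have x_le: "x n $ i < a $ i + 1 / real (Suc n)" "a $ i + 1 / real (Suc (Suc n)) < x n $ i" for n i
      using x(1)[of n] by (auto simp: mem_box_cart c_def)
    have "decseq (\<lambda>n. {..x n})"
      unfolding decseq_Suc_iff
    proof
      fix n
      have "x (Suc n) $ i \<le> x n $ i" for i
        using x_le(1)[of "Suc n" i] x_le(2)[of i n] by linarith
      then show "{..x (Suc n)} \<subseteq> {..x n}"
        by (auto simp: less_eq_vec_def intro: order_trans)
    qed
    moreover have "(\<Inter>n. {..x n}) = {..a}"
    proof (intro equalityI subsetI)
      fix y assume y: "y \<in> (\<Inter>n. {..x n})"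
      have "y $ i \<le> a $ i" for i
      proof (rule field_le_epsilon)
        fix e :: real assume "0 < e"
        then obtain n where "1 / real (Suc n) < e"
          using nat_approx_posE by blast
        moreover have "y $ i \<le> x n $ i" using y by (auto simp: less_eq_vec_def)
        ultimately show "y $ i \<le> a $ i + e" using x_le(1)[of n i] by linarith
      qed
      then show "y \<in> {..a}" by (auto simp: less_eq_vec_def)
    next
      fix y assume y: "y \<in> {..a}"
      have "y $ i \<le> x n $ i" for n i
      proof -
        have "y $ i \<le> a $ i" using y by (auto simp: less_eq_vec_def)
        also have "\<dots> \<le> a $ i + 1 / real (Suc (Suc n))" by simp
        also have "\<dots> \<le> x n $ i" using x_le(2)[of i n] by simp
        finally show ?thesis .
      qed
      then show "y \<in> (\<Inter>n. {..x n})" by (auto simp: less_eq_vec_def)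
    qed
    moreover have "range (\<lambda>n. {..x n}) \<subseteq> sets borel"
      using borel_closed[OF closed_eucl_atMost] by auto
    ultimately have "(\<lambda>n. measure M {..x n}) \<longlonglongrightarrow> measure M {..a}"
        "(\<lambda>n. measure N {..x n}) \<longlonglongrightarrow> measure N {..a}"
      using M.finite_Lim_measure_decseq[of "\<lambda>n. {..x n}"] N.finite_Lim_measure_decseq[of "\<lambda>n. {..x n}"]
      by (simp_all add: M N)
    then show ?thesis using x(2) LIMSEQ_unique by simp
  qed
  show ?thesis
  proof (rule measure_eqI_generator_eq[where E = "range atMost" and \<Omega> = UNIV
        and A = "\<lambda>n. {..(\<chi> i. real n)}"])
    show "Int_stable (range (atMost :: real ^ 'j \<Rightarrow> _))"
    proof -
      have "{..a} \<inter> {..b} = {..inf a b}" for a b :: "real ^ 'j" by auto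
      then show ?thesis by (auto simp: Int_stable_def)
    qed
    show "sets M = sigma_sets UNIV (range atMost)" "sets N = sigma_sets UNIV (range atMost)"
      using M N by (simp_all add: borel_eq_atMost)
    show "(\<Union>n. {..(\<chi> i. real n) :: real ^ 'j}) = UNIV"
    proof safe
      fix x :: "real ^ 'j"
      obtain n :: nat where "norm x \<le> real n" using real_arch_simple by blast
      then have "x $ i \<le> real n" for i
        using component_le_norm_cart[of x i] by linarith
      then show "x \<in> (\<Union>n. {..(\<chi> i. real n) :: real ^ 'j})"
        by (auto simp: less_eq_vec_def intro!: exI[of _ n])
    qed auto
    show "emeasure M X = emeasure N X" if "X \<in> range atMost" for X
      using that eq by (auto simp: M.emeasure_eq_measure N.emeasure_eq_measure)
    show "emeasure M {..(\<chi> i. real n)} \<noteq> \<infinity>" for n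
      by simp
  qed auto
qed

section \<open>Moments of the coefficients\<close>

text \<open>The monomials in \<open>u\<close> are kept apart so that integrating over \<open>u\<close> leaves a polynomial in \<open>w\<close>.\<close>

inductive coef_poly ::
    "(('k::finite, 'j::finite) covs \<Rightarrow> (real ^ 'k) \<times> (real ^ 'j) \<Rightarrow> real) \<Rightarrow> bool" where
  monom: "real_polynomial_function g \<Longrightarrow> coef_poly (\<lambda>w u. g w * monomial a b u)"
| plus: "coef_poly f \<Longrightarrow> coef_poly g \<Longrightarrow> coef_poly (\<lambda>w u. f w u + g w u)"

lemma monomial_mult:
  "monomial a b u * monomial a' b' u = monomial (\<lambda>i. a i + a' i) (\<lambda>y. b y + b' y) u"
  by (simp add: monomial_def power_add prod.distrib split: prod.split)

lemma coef_poly_mult: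
  assumes "coef_poly f" "coef_poly g"
  shows "coef_poly (\<lambda>w u. f w u * g w u)"
  using assms(1)
proof induction
  case (monom h a b)
  from assms(2) show ?case
  proof induction
    case (monom h' a' b')
    have "(\<lambda>w u. h w * monomial a b u * (h' w * monomial a' b' u))
        = (\<lambda>w u. (h w * h' w) * monomial (\<lambda>i. a i + a' i) (\<lambda>y. b y + b' y) u)"
      by (simp add: monomial_mult[symmetric] mult_ac)
    then show ?case
      using coef_poly.monom[OF real_polynomial_function.intros(4)[OF \<open>real_polynomial_function h\<close> monom]] by simp
  next
    case (plus f g)
    then show ?case using coef_poly.plus[OF plus.IH] by (simp add: distrib_left)
  qed
next
  case (plus f g)
  then show ?case using coef_poly.plus[OF plus.IH] by (simp add: distrib_right)
qed

lemma coef_poly_monomial: "coef_poly (\<lambda>w. monomial a b)"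
  using coef_poly.monom[OF real_polynomial_function.intros(2)[of 1], of a b] by simp

lemma coef_poly_const: "coef_poly (\<lambda>w u. c)"
  using coef_poly.monom[OF real_polynomial_function.intros(2)[of c], of "\<lambda>_. 0" "\<lambda>_. 0"]
  by (simp add: monomial_def split_def)

lemma coef_poly_power: "coef_poly f \<Longrightarrow> coef_poly (\<lambda>w u. f w u ^ n)"
  by (induction n) (simp_all add: coef_poly_const coef_poly_mult)

lemma coef_poly_prod: "finite I \<Longrightarrow> (\<And>i. i \<in> I \<Longrightarrow> coef_poly (f i)) \<Longrightarrow> coef_poly (\<lambda>w u. \<Prod>i\<in>I. f i w u)"
  by (induction I rule: finite_induct) (simp_all add: coef_poly_const coef_poly_mult)

lemma coef_poly_sum: "finite I \<Longrightarrow> (\<And>i. i \<in> I \<Longrightarrow> coef_poly (f i)) \<Longrightarrow> coef_poly (\<lambda>w u. \<Sum>i\<in>I. f i w u)"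
  by (induction I rule: finite_induct) (simp_all add: coef_poly_const coef_poly.plus)

lemma monomial_fst: "monomial (\<lambda>l. if l = i then 1 else 0) (\<lambda>_. 0) = (\<lambda>u. fst u $ i)"
  by (simp add: fun_eq_iff monomial_def if_distrib[of "\<lambda>n. _ ^ n"] split_def cong: if_cong)

lemma monomial_snd: "monomial (\<lambda>_. 0) (\<lambda>l. if l = y then 1 else 0) = (\<lambda>u. snd u $ y)"
  by (simp add: fun_eq_iff monomial_def if_distrib[of "\<lambda>n. _ ^ n"] split_def cong: if_cong)

lemma coef_poly_times_fst:
  assumes "real_polynomial_function g"
  shows "coef_poly (\<lambda>w u. g w * fst u $ i)"
  using coef_poly.monom[OF assms, of "\<lambda>l. if l = i then 1 else 0" "\<lambda>_. 0"]
  by (simp only: monomial_fst)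

lemma coef_poly_snd: "coef_poly (\<lambda>w u. snd u $ y)"
  using coef_poly_monomial[of "\<lambda>_. 0" "\<lambda>l. if l = y then 1 else 0"]
  by (simp only: monomial_snd)

text \<open>The counterpart of \<open>lat_eps\<close> on the coefficients alone, so that the law of
  \<epsilon> given w is an image of the law of (\<theta>, \<zeta>) given w.\<close>

definition coef_eps :: "('k::finite, 'j::finite) covs \<Rightarrow> (real ^ 'k) \<times> (real ^ 'j) \<Rightarrow> real ^ 'j" where
  "coef_eps w u = (\<chi> y. fst u \<bullet> (w $ y) + snd u $ y)"

lemma measurable_coef_eps [measurable]: "coef_eps w \<in> borel_measurable borel"
  unfolding coef_eps_def by (intro borel_measurable_continuous_onI continuous_intros)

lemma coef_poly_eps:
  fixes y :: "'j::finite"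
  shows "coef_poly (\<lambda>(w :: ('k::finite, 'j) covs) u. coef_eps w u $ y)"
proof -
  have "real_polynomial_function (\<lambda>w::('k, 'j) covs. w $ y $ i)" for y i
    by (intro real_polynomial_function.intros(1) bounded_linear_compose[OF bounded_linear_vec_nth bounded_linear_vec_nth])
  then have "coef_poly (\<lambda>(w :: ('k, 'j) covs) u. (\<Sum>i\<in>UNIV. w $ y $ i * fst u $ i) + snd u $ y)"
    by (intro coef_poly.plus coef_poly_sum coef_poly_times_fst coef_poly_snd) auto
  then show ?thesis
    by (simp add: coef_eps_def inner_vec_def mult.commute)
qed

lemma
  assumes M: "finite_abs_moments M" "sets M = sets borel" and "coef_poly f"
  shows coef_poly_integrable: "integrable M (f w)"
    and coef_poly_integral: "real_polynomial_function (\<lambda>w. LINT u|M. f w u)"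
proof -
  have mono: "integrable M (monomial a b)" for a b
  proof -
    have "(monomial a b :: (real ^ 'a) \<times> (real ^ 'b) \<Rightarrow> real) \<in> borel_measurable M"
      unfolding measurable_cong_sets[OF M(2) refl] monomial_def split_def
      by (intro borel_measurable_continuous_onI continuous_intros)
    then show ?thesis
      using M(1) by (subst integrable_abs_iff[symmetric]) (auto simp: finite_abs_moments_def)
  qed
  have "(\<forall>w. integrable M (f w)) \<and> real_polynomial_function (\<lambda>w. LINT u|M. f w u)"
    using assms(3)
  proof induction
    case (monom g a b)
    then show ?case by (auto simp: mono intro: real_polynomial_function.intros(4) real_polynomial_function.intros(2))
  next
    case (plus f g)
    then show ?case by (auto intro: real_polynomial_function.intros(3))
  qed
  then show "integrable M (f w)" "real_polynomial_function (\<lambda>w. LINT u|M. f w u)" by auto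
qed

text \<open>By continuity, zeros in every open subset of the ball spread to the whole ball. The line
  from the centre to x then carries a univariate polynomial with infinitely many zeros.\<close>

lemma real_polynomial_function_eq_0:
  fixes p :: "'a::euclidean_space \<Rightarrow> real"
  assumes p: "real_polynomial_function p" and r: "r > 0"
    and zero: "\<And>U. open U \<Longrightarrow> U \<noteq> {} \<Longrightarrow> U \<subseteq> ball c r \<Longrightarrow> \<exists>x\<in>U. p x = 0"
  shows "p x = 0"
proof -
  have cont: "continuous_on UNIV p"
    using p by (simp add: continuous_on_polymonial_function real_polynomial_function_eq)
  have ball: "p y = 0" if y: "y \<in> ball c r" for y
  proof (rule ccontr)
    assume "p y \<noteq> 0"
    have "open (p -` (- {0}) \<inter> ball c r)"
      using cont by (intro open_Int open_vimage) (auto simp: open_Compl)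
    moreover have "p -` (- {0}) \<inter> ball c r \<noteq> {}" using y \<open>p y \<noteq> 0\<close> by auto
    ultimately show False using zero by fastforce
  qed
  have "real_polynomial_function (\<lambda>t::real. p (c + t *\<^sub>R (x - c)))"
  proof -
    have "polynomial_function (\<lambda>t::real. c + t *\<^sub>R (x - c))"
      by (intro polynomial_function_add polynomial_function_const polynomial_function_bounded_linear
          bounded_linear_scaleR_left)
    from real_polynomial_function_compose[OF this p] show ?thesis by (simp add: o_def)
  qed
  then obtain a n where an: "\<And>t. p (c + t *\<^sub>R (x - c)) = (\<Sum>i\<le>n. a i * t ^ i)"
    unfolding real_polynomial_function_iff_sum by metis
  \<comment> \<open>For 0 < t < m the point c + t (x - c) stays in the ball; the added 1 covers x =
    c.\<close>
  define m where "m = r / (norm (x - c) + 1)"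
  have m: "m > 0" using r by (simp add: m_def add_nonneg_pos)
  have "(\<Sum>i\<le>n. a i * t ^ i) = 0" if "t \<in> {0<..<m}" for t
  proof -
    have "t * norm (x - c) \<le> t * (norm (x - c) + 1)"
      using that by simp
    also have "\<dots> < r"
      using that by (simp add: m_def pos_less_divide_eq add_nonneg_pos)
    finally have "c + t *\<^sub>R (x - c) \<in> ball c r" using that by (simp add: dist_norm)
    then show ?thesis using an ball by metis
  qed
  then have "\<not> finite {t. (\<Sum>i\<le>n. a i * t ^ i) = 0}"
    using infinite_Ioo[OF m] by (metis (mono_tags, lifting) finite_subset mem_Collect_eq subsetI)
  then have "a i = 0" if "i \<le> n" for i
    using polyfun_finite_roots[where c = a and n = n] that by blast
  then have "p (c + 1 *\<^sub>R (x - c)) = 0" unfolding an by simp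
  then show ?thesis by simp
qed

text \<open>Both sides of \<open>eq\<close> are polynomials in t, so their coefficients at the power
  m agree, and the nonzero factor \<open>m + n choose m\<close> cancels. Regarding f, g and h as
  functions of a dummy w lets \<open>coef_poly_integrable\<close> supply the integrability.\<close>

lemma integral_binomial_coeff_eq:
  fixes P P' :: "((real ^ 'k::finite) \<times> (real ^ 'j::finite)) measure"
  assumes P: "finite_abs_moments P" "sets P = sets borel"
    and P': "finite_abs_moments P'" "sets P' = sets borel"
    and fgh: "coef_poly (\<lambda>(w :: ('k, 'j) covs). f)" "coef_poly (\<lambda>(w :: ('k, 'j) covs). g)"
      "coef_poly (\<lambda>(w :: ('k, 'j) covs). h)"
    and eq: "\<And>t. (LINT u|P. f u * (t * h u + g u) ^ (m + n)) = (LINT u|P'. f u * (t * h u + g u) ^ (m + n))"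
  shows "(LINT u|P. f u * h u ^ m * g u ^ n) = (LINT u|P'. f u * h u ^ m * g u ^ n)"
proof -
  define q where "q k u = f u * h u ^ k * g u ^ (m + n - k)" for k u
  have cp: "coef_poly (\<lambda>(w :: ('k, 'j) covs). q k)" for k
    unfolding q_def using fgh by (intro coef_poly_mult coef_poly_power)
  have int: "integrable P (q k)" "integrable P' (q k)" for k
    using coef_poly_integrable[OF P cp] coef_poly_integrable[OF P' cp] .
  have expand: "f u * (t * h u + g u) ^ (m + n)
      = (\<Sum>k\<le>m+n. real (m + n choose k) * t ^ k * q k u)" for t u
    by (simp add: binomial_ring sum_distrib_left q_def power_mult_distrib mult_ac)
  have "(\<Sum>k\<le>m+n. (real (m + n choose k) * (integral\<^sup>L P (q k) - integral\<^sup>L P' (q k))) * t ^ k) = 0" for t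
  proof -
    have "(\<Sum>k\<le>m+n. real (m + n choose k) * t ^ k * integral\<^sup>L P (q k))
        = (\<Sum>k\<le>m+n. real (m + n choose k) * t ^ k * integral\<^sup>L P' (q k))"
      using eq[of t] int by (simp add: expand)
    then show ?thesis by (simp add: algebra_simps sum_subtractf)
  qed
  then have "\<forall>k\<le>m+n. real (m + n choose k) * (integral\<^sup>L P (q k) - integral\<^sup>L P' (q k)) = 0"
    using polyfun_eq_0[of "\<lambda>k. real (m + n choose k) * (integral\<^sup>L P (q k) - integral\<^sup>L P' (q k))" "m + n"]
    by blast
  then have "real (m + n choose m) * (integral\<^sup>L P (q m) - integral\<^sup>L P' (q m)) = 0" by simp
  then have "integral\<^sup>L P (q m) = integral\<^sup>L P' (q m)" by simp
  then show ?thesis by (simp add: q_def[abs_def])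
qed

text \<open>As polynomials in w, the moments of \<epsilon> agree for every w, so w may be chosen far
  from the ball. Setting the covariates of all products but one to 0 exposes their \<zeta>; varying
  the remaining covariate vector extracts the powers of the coordinates of \<theta> one at a
  time.\<close>

lemma monomial_integral_eq:
  fixes P P' :: "((real ^ 'k::finite) \<times> (real ^ 'j::finite)) measure" and c :: "('k, 'j) covs"
  assumes P: "finite_abs_moments P" "sets P = sets borel"
    and P': "finite_abs_moments P'" "sets P' = sets borel"
    and "r > 0"
    and dense: "\<And>U. open U \<Longrightarrow> U \<noteq> {} \<Longrightarrow> U \<subseteq> ball c r \<Longrightarrow>
      \<exists>w\<in>U. distr P borel (coef_eps w) = distr P' borel (coef_eps w)"
  shows "(LINT u|P. monomial a b u) = (LINT u|P'. monomial a b u)"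
proof -
  have [measurable_cong]: "sets P = sets borel" "sets P' = sets borel" by fact+
  have eps_eq: "(LINT u|P. (\<Prod>y\<in>UNIV. coef_eps w u $ y ^ n y)) = (LINT u|P'. (\<Prod>y\<in>UNIV. coef_eps w u $ y ^ n y))"
    for n and w :: "('k, 'j) covs"
  proof -
    define f where "f w u = (\<Prod>y\<in>UNIV. coef_eps w u $ y ^ n y)" for w :: "('k, 'j) covs" and u
    have f: "coef_poly f"
      unfolding f_def by (intro coef_poly_prod coef_poly_power coef_poly_eps) simp
    have "(LINT u|P. f w u) - (LINT u|P'. f w u) = 0"
    proof (rule real_polynomial_function_eq_0[where p = "\<lambda>w. (LINT u|P. f w u) - (LINT u|P'. f w u)",
          OF _ \<open>r > 0\<close>])
      show "real_polynomial_function (\<lambda>w. (LINT u|P. f w u) - (LINT u|P'. f w u))"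
        using coef_poly_integral[OF P f] coef_poly_integral[OF P' f] by auto
      fix U assume "open U" "U \<noteq> {}" "U \<subseteq> ball c r"
      then obtain w where w: "w \<in> U" "distr P borel (coef_eps w) = distr P' borel (coef_eps w)"
        using dense by blast
      have [measurable]: "(\<lambda>t :: real ^ 'j. \<Prod>y\<in>UNIV. t $ y ^ n y) \<in> borel_measurable borel"
        by (intro borel_measurable_continuous_onI continuous_intros)
      have "(LINT u|P. f w u) = (LINT t|distr P borel (coef_eps w). (\<Prod>y\<in>UNIV. t $ y ^ n y))"
        unfolding f_def by (subst integral_distr) auto
      also have "\<dots> = (LINT u|P'. f w u)"
        unfolding f_def w(2) by (subst integral_distr) auto
      finally show "\<exists>w\<in>U. (LINT u|P. f w u) - (LINT u|P'. f w u) = 0"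
        using w(1) by auto
    qed
    then show ?thesis by (simp add: f_def)
  qed
  \<comment> \<open>The product whose covariates are varied; it carries all powers of \<theta>, and
    any choice serves.\<close>
  fix y0 :: 'j
  define Z where "Z u = (\<Prod>y\<in>-{y0}. snd u $ y ^ b y)" for u :: "(real ^ 'k) \<times> (real ^ 'j)"
  define X where "X I u = (\<Prod>i\<in>I. fst u $ i ^ a i) * Z u" for I and u :: "(real ^ 'k) \<times> (real ^ 'j)"
  have cp_fst: "coef_poly (\<lambda>(w :: ('k, 'j) covs) u. fst u $ i)" for i
    using coef_poly_times_fst[OF real_polynomial_function.intros(2)[of 1]] by simp
  have cp_X: "coef_poly (\<lambda>w :: ('k, 'j) covs. X I)" for I
    unfolding X_def Z_def by (intro coef_poly_mult coef_poly_prod coef_poly_power cp_fst coef_poly_snd) auto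
  define G where "G I v u = (\<Sum>i\<in>-I. v i * fst u $ i) + snd u $ y0"
    for I v and u :: "(real ^ 'k) \<times> (real ^ 'j)"
  have cp_G: "coef_poly (\<lambda>w :: ('k, 'j) covs. G I v)" for I v
    unfolding G_def
    by (intro coef_poly.plus coef_poly_sum coef_poly_mult coef_poly_const cp_fst coef_poly_snd) auto
  \<comment> \<open>\<open>I\<close> holds the coordinates of \<theta> already extracted with powers
    \<open>a i\<close>; the others are still inside the linear form \<open>G I v\<close>. Both
    \<open>v\<close> and \<open>N\<close> must be general, since extracting \<open>j\<close>
    replaces \<open>v j\<close> by a variable t and uses the exponent
    \<open>a j + N\<close>.\<close>
  have "(LINT u|P. X I u * G I v u ^ N) = (LINT u|P'. X I u * G I v u ^ N)" for I v N
    using finite[of I]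
  proof (induction I arbitrary: v N rule: finite_induct)
    case empty
    define w :: "('k, 'j) covs" where "w = (\<chi> y. if y = y0 then (\<chi> i. v i) else 0)"
    define n where "n = b(y0 := N)"
    have "(\<Prod>y\<in>UNIV. coef_eps w u $ y ^ n y) = X {} u * G {} v u ^ N" for u
    proof -
      have "(\<Prod>y\<in>UNIV. coef_eps w u $ y ^ n y) = coef_eps w u $ y0 ^ n y0 * (\<Prod>y\<in>-{y0}. coef_eps w u $ y ^ n y)"
        by (subst prod.remove[of _ y0]) (auto simp: Compl_eq_Diff_UNIV)
      moreover have "coef_eps w u $ y0 ^ n y0 = G {} v u ^ N"
        by (simp add: coef_eps_def w_def n_def G_def inner_vec_def mult.commute)
      moreover have "(\<Prod>y\<in>-{y0}. coef_eps w u $ y ^ n y) = X {} u"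
        unfolding X_def Z_def by (simp add: coef_eps_def w_def n_def)
      ultimately show ?thesis by simp
    qed
    then show ?case using eps_eq[of w n] by simp
  next
    case (insert j I)
    have G: "G I (v(j := t)) u = t * fst u $ j + G (insert j I) v u" for t u
    proof -
      have "- I = insert j (- insert j I)" using insert by auto
      then have "(\<Sum>i\<in>-I. (v(j := t)) i * fst u $ i)
          = t * fst u $ j + (\<Sum>i\<in>- insert j I. (v(j := t)) i * fst u $ i)"
        by (metis (no_types, lifting) ComplD finite fun_upd_same insertI1 sum.insert)
      also have "(\<Sum>i\<in>- insert j I. (v(j := t)) i * fst u $ i) = (\<Sum>i\<in>- insert j I. v i * fst u $ i)"
        by (intro sum.cong) auto
      finally show ?thesis by (simp add: G_def)
    qed
    have X: "X (insert j I) u = X I u * fst u $ j ^ a j" for u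
      using insert by (simp add: X_def)
    have "(LINT u|P. X I u * fst u $ j ^ a j * G (insert j I) v u ^ N)
        = (LINT u|P'. X I u * fst u $ j ^ a j * G (insert j I) v u ^ N)"
      by (rule integral_binomial_coeff_eq[OF P P' cp_X cp_G cp_fst]) (simp only: insert.IH G[symmetric])
    then show ?case by (simp only: X)
  qed
  \<comment> \<open>With every coordinate extracted the sum in \<open>G\<close> is empty, and what
    remains is the \<zeta> of \<open>y0\<close> with its power \<open>b y0\<close>.\<close>
  from this[of UNIV "\<lambda>_. 0" "b y0"] show ?thesis
  proof -
    have "X UNIV u * G UNIV (\<lambda>_. 0) u ^ b y0 = monomial a b u" for u
      unfolding X_def Z_def G_def monomial_def split_def
      by (subst (2) prod.remove[of _ y0]) (auto simp: Compl_eq_Diff_UNIV)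
    then show ?thesis
      using \<open>(LINT u|P. X UNIV u * G UNIV (\<lambda>_. 0) u ^ b y0) = (LINT u|P'. X UNIV u * G UNIV (\<lambda>_. 0) u ^ b y0)\<close>
      by simp
  qed
qed

section \<open>The laws of a structure\<close>

lemma measurable_lat_e [measurable]: "lat_e \<in> borel_measurable borel"
  and measurable_lat_coef [measurable]: "lat_coef \<in> borel_measurable borel"
  and measurable_lat_eps [measurable]: "lat_eps w \<in> borel_measurable borel"
  and measurable_index_v [measurable]: "index_v S w d \<in> borel_measurable borel"
  unfolding lat_e_def lat_coef_def lat_eps_def index_v_def split_def
  by (intro borel_measurable_continuous_onI continuous_intros)+

lemma lat_eps_eq: "lat_eps w l = coef_eps w (lat_coef l)"
  by (simp add: lat_eps_def coef_eps_def lat_coef_def split_def)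

lemma measurable_snd_snd [measurable]:
  fixes f :: "'c::topological_space \<Rightarrow> 'd::topological_space"
  assumes "f \<in> borel_measurable borel"
  shows "(\<lambda>(d :: 'a::second_countable_topology, z :: 'b::second_countable_topology, l). f l)
    \<in> borel_measurable borel"
proof -
  have "(\<lambda>x :: 'a \<times> 'b \<times> 'c. snd (snd x)) \<in> borel_measurable borel"
    by (intro borel_measurable_continuous_onI continuous_intros)
  from measurable_compose[OF this assms] show ?thesis by (simp add: split_def)
qed

text \<open>For a single event A, independence equates two densities with respect to M, which gives
  equality almost everywhere. The exceptional set depends on A; a countable generator closed under
  intersections yields one null set for all events.\<close>

lemma AE_kernel_eq_const:
  fixes M :: "'a::second_countable_topology measure"
    and K :: "'a \<Rightarrow> 'b::second_countable_topology measure"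
  assumes M: "M \<in> space (prob_algebra borel)" and K: "K \<in> borel \<rightarrow>\<^sub>M prob_algebra borel"
    and P: "P \<in> space (prob_algebra borel)"
    and indep: "\<And>A B. A \<in> sets borel \<Longrightarrow> B \<in> sets borel \<Longrightarrow>
      (\<integral>\<^sup>+w\<in>B. emeasure (K w) A \<partial>M) = emeasure P A * emeasure M B"
  shows "AE w in M. K w = P"
proof -
  have sM[measurable_cong]: "sets M = sets borel" and "prob_space M"
    and sP: "sets P = sets borel" and "prob_space P"
    using M P by (auto simp: space_prob_algebra)
  interpret M: prob_space M by fact
  interpret P: prob_space P by fact
  have sK: "sets (K w) = sets borel" "prob_space (K w)" for w
    using measurable_space[OF K, of w] by (auto simp: space_prob_algebra)
  obtain \<B> :: "'b set set" where \<B>: "countable \<B>" "topological_basis \<B>"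
    using ex_countable_basis by blast
  \<comment> \<open>Finite intersections of basic sets are still countably many and generate the
    Borel sets; the empty intersection supplies UNIV.\<close>
  define G where "G = Inter ` {F. finite F \<and> F \<subseteq> \<B>}"
  have "countable G"
    unfolding G_def using \<B>(1) by (intro countable_image countable_Collect_finite_subset)
  have "Int_stable G"
  proof (rule Int_stableI)
    fix A B assume "A \<in> G" "B \<in> G"
    then obtain F F' where "finite F" "F \<subseteq> \<B>" "A = \<Inter>F" "finite F'" "F' \<subseteq> \<B>" "B = \<Inter>F'"
      by (auto simp: G_def)
    then show "A \<inter> B \<in> G"
      unfolding G_def by (intro image_eqI[of _ _ "F \<union> F'"]) (auto simp: Inter_Un_distrib)
  qed
  have G_open: "open A" if "A \<in> G" for A
    using that topological_basis_open[OF \<B>(2)] unfolding G_def by (auto intro!: open_Inter)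
  have sets_G: "sets borel = sigma_sets UNIV G"
  proof
    have "\<B> \<subseteq> G"
      unfolding G_def by (auto intro!: image_eqI[of _ _ "{A}" for A])
    then have "sigma_sets UNIV \<B> \<subseteq> sigma_sets UNIV G"
      by (rule sigma_sets_mono')
    then show "sets borel \<subseteq> sigma_sets UNIV G"
      by (subst borel_eq_countable_basis[OF \<B>]) simp
    show "sigma_sets UNIV G \<subseteq> sets borel"
    proof -
      have "G \<subseteq> sets borel" using G_open by auto
      then show ?thesis using sets.sigma_sets_subset[of G borel] by simp
    qed
  qed
  have "UNIV \<in> G" unfolding G_def by (intro image_eqI[of _ _ "{}"]) auto
  have "AE w in M. emeasure (K w) A = emeasure P A" if "A \<in> G" for A
  proof -
    have A[measurable]: "A \<in> sets borel" using G_open[OF that] by simp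
    have [measurable]: "(\<lambda>w. emeasure (K w) A) \<in> borel_measurable borel"
      using measurable_prob_algebraD[OF K] by measurable
    have "density M (\<lambda>w. emeasure (K w) A) = density M (\<lambda>w. emeasure P A)"
      by (rule measure_eqI) (auto simp: emeasure_density indep sM nn_integral_cmult_indicator)
    then show ?thesis
      by (intro M.density_unique) auto
  qed
  then have "AE w in M. \<forall>A\<in>G. emeasure (K w) A = emeasure P A"
    using \<open>countable G\<close> by (subst AE_ball_countable) auto
  then show ?thesis
  proof eventually_elim
    case (elim w)
    interpret Kw: prob_space "K w" by (rule sK)
    show ?case
    proof (rule measure_eqI_generator_eq[OF \<open>Int_stable G\<close>, where A = "\<lambda>_. UNIV" and \<Omega> = UNIV])
      show "sets (K w) = sigma_sets UNIV G" "sets P = sigma_sets UNIV G"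
        using sK(1) sP sets_G by auto
    qed (use elim \<open>UNIV \<in> G\<close> in auto)
  qed
qed

locale choice_model =
  fixes ob :: "('k::finite, 'j::finite) observables"
    and S :: "('k, 'j) struct"
    and \<kappa> :: enat
  assumes valid_ob: "valid_observables ob"
    and valid_S: "valid_struct ob S"
    and cond_indep: "cond_independence ob S"
    and normal: "normalization \<kappa> ob S"
    and v_compl: "v_complete ob S"
begin

section \<open>Measurability of the kernels and of the laws given w\<close>

lemma ker_z_measurable [measurable]: "ker_z ob \<in> borel \<rightarrow>\<^sub>M prob_algebra borel"
  and ker_d_measurable: "ker_d ob \<in> borel \<rightarrow>\<^sub>M prob_algebra borel"
  and ker_d_measurable' [measurable]: "ker_d ob \<in> borel \<Otimes>\<^sub>M borel \<rightarrow>\<^sub>M prob_algebra borel"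
  and ker_lat_measurable: "ker_lat S \<in> borel \<rightarrow>\<^sub>M prob_algebra borel"
  and ker_lat_measurable' [measurable]:
    "ker_lat S \<in> borel \<Otimes>\<^sub>M borel \<Otimes>\<^sub>M borel \<rightarrow>\<^sub>M prob_algebra borel"
  and law_w_prob: "law_w ob \<in> space (prob_algebra borel)"
  using valid_ob valid_S
  by (auto simp: valid_observables_def valid_struct_def borel_prod space_prob_algebra)

text \<open>Measurability is composed over products of sigma-algebras, whereas the definitions use
  \<open>borel\<close> on product types; \<open>borel_prod\<close> passes between the two. The
  primed kernel facts above serve the same purpose.\<close>

lemma law_given_w_measurable [measurable]: "law_given_w ob S \<in> borel \<rightarrow>\<^sub>M prob_algebra borel"
proof -
  have [measurable]: "(\<lambda>x. return (borel \<Otimes>\<^sub>M borel \<Otimes>\<^sub>M borel) x) \<in>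
      borel \<Otimes>\<^sub>M borel \<Otimes>\<^sub>M borel \<rightarrow>\<^sub>M prob_algebra (borel \<Otimes>\<^sub>M borel \<Otimes>\<^sub>M (borel :: ('k,'j) latent measure))"
    by (rule measurable_return_prob_space)
  have "(\<lambda>w. ker_z ob w \<bind> (\<lambda>z. ker_d ob (z, w) \<bind> (\<lambda>d. ker_lat S (d, z, w) \<bind>
     (\<lambda>l. return (borel \<Otimes>\<^sub>M borel \<Otimes>\<^sub>M borel) (d, z, l))))) \<in> borel \<rightarrow>\<^sub>M prob_algebra (borel \<Otimes>\<^sub>M borel \<Otimes>\<^sub>M borel)"
    by measurable
  then show ?thesis
    by (simp add: borel_prod law_given_w_def[abs_def])
qed

lemma law_given_w_space: "law_given_w ob S w \<in> space (prob_algebra borel)"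
  using measurable_space[OF law_given_w_measurable] by simp

lemma prob_law_given_w: "prob_space (law_given_w ob S w)"
  and sets_law_given_w [measurable_cong]: "sets (law_given_w ob S w) = sets borel"
  using law_given_w_space[of w] by (auto simp: space_prob_algebra)

lemma sets_ker_lat [measurable_cong]: "sets (ker_lat S x) = sets borel"
  using measurable_space[OF ker_lat_measurable, of x] by (simp add: space_prob_algebra)

lemma sets_law_w [measurable_cong]: "sets (law_w ob) = sets borel"
  using law_w_prob by (simp add: space_prob_algebra)

lemma prob_law_e_w: "prob_space (law_e_w ob S w)"
  and sets_law_e_w [measurable_cong]: "sets (law_e_w ob S w) = sets borel"
proof -
  interpret prob_space "law_given_w ob S w" by (rule prob_law_given_w)
  show "prob_space (law_e_w ob S w)" unfolding law_e_w_def by (rule prob_space_distr) simp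
qed (simp add: law_e_w_def)

definition law_eps_w :: "('k, 'j) covs \<Rightarrow> (real ^ 'j) measure" where
  "law_eps_w w = distr (law_given_w ob S w) borel (\<lambda>(d, z, l). lat_eps w l)"

lemma prob_law_eps_w: "prob_space (law_eps_w w)"
  and sets_law_eps_w [measurable_cong]: "sets (law_eps_w w) = sets borel"
proof -
  interpret prob_space "law_given_w ob S w" by (rule prob_law_given_w)
  show "prob_space (law_eps_w w)" unfolding law_eps_w_def by (rule prob_space_distr) simp
qed (simp add: law_eps_w_def)

section \<open>Joint and conditional supports\<close>

lemma in_supp_x:
  "w \<in> supp_w ob \<Longrightarrow> z \<in> supp_z ob w \<Longrightarrow> d \<in> supp_d ob z w \<Longrightarrow> (d, z, w) \<in> supp_x ob"
  using valid_ob by (auto simp: valid_observables_def)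

text \<open>A point (d, z) of the joint support need not have d in the conditional support at that
  z. The joint law is nevertheless concentrated on pairs that do, so an open set of positive mass
  contains one.\<close>

lemma open_meets_supports:
  assumes "open U" and "U \<inter> msupport (law_dz ob w) \<noteq> {}"
  shows "\<exists>z\<in>supp_z ob w. \<exists>d\<in>supp_d ob z w. (d, z) \<in> U"
proof (rule ccontr)
  assume neg: "\<not> ?thesis"
  have [measurable]: "U \<in> sets borel" using assms(1) by simp
  have kz: "ker_z ob w \<in> space (prob_algebra borel)"
    using measurable_space[OF ker_z_measurable] by simp
  have "(\<lambda>z. ker_d ob (z, w) \<bind> (\<lambda>d. return (borel \<Otimes>\<^sub>M borel) (d, z)))
      \<in> borel \<rightarrow>\<^sub>M prob_algebra (borel \<Otimes>\<^sub>M borel)"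
    by measurable
  then have inner: "(\<lambda>z. ker_d ob (z, w) \<bind> (\<lambda>d. return borel (d, z))) \<in> borel \<rightarrow>\<^sub>M prob_algebra borel"
    by (simp add: borel_prod)
  have "emeasure (law_dz ob w) U = (\<integral>\<^sup>+z. emeasure (ker_d ob (z, w) \<bind> (\<lambda>d. return borel (d, z))) U \<partial>ker_z ob w)"
    unfolding law_dz_def by (rule emeasure_bind_prob_algebra[OF kz inner]) simp
  also have "\<dots> = (\<integral>\<^sup>+z. 0 \<partial>ker_z ob w)"
  proof (rule nn_integral_cong_AE)
    have "AE z in ker_z ob w. z \<in> supp_z ob w"
      unfolding supp_z_def using kz by (intro AE_msupport) (simp add: space_prob_algebra)
    then show "AE z in ker_z ob w. emeasure (ker_d ob (z, w) \<bind> (\<lambda>d. return borel (d, z))) U = 0"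
    proof eventually_elim
      case (elim z)
      have kd: "ker_d ob (z, w) \<in> space (prob_algebra borel)"
        using measurable_space[OF ker_d_measurable] by simp
      have ret: "(\<lambda>d :: real. return borel (d, z)) \<in> borel \<rightarrow>\<^sub>M prob_algebra borel"
        by (intro measurable_compose[OF _ measurable_return_prob_space] borel_measurable_Pair) auto
      have "emeasure (ker_d ob (z, w) \<bind> (\<lambda>d. return borel (d, z))) U
          = (\<integral>\<^sup>+d. indicator U (d, z) \<partial>ker_d ob (z, w))"
        by (subst emeasure_bind_prob_algebra[OF kd ret]) auto
      also have "\<dots> = (\<integral>\<^sup>+d. 0 \<partial>ker_d ob (z, w))"
      proof (rule nn_integral_cong_AE)
        have "AE d in ker_d ob (z, w). d \<in> supp_d ob z w"
          unfolding supp_d_def using kd by (intro AE_msupport) (simp add: space_prob_algebra)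
        then show "AE d in ker_d ob (z, w). indicator U (d, z) = (0 :: ennreal)"
          by eventually_elim (use neg elim in auto)
      qed
      finally show ?case by simp
    qed
  qed
  finally have "emeasure (law_dz ob w) U = 0" by simp
  with assms show False by (auto simp: msupport_def)
qed

text \<open>The neighbourhood from \<open>normalization\<close> is shrunk to a product, so that d
  can be confined to one side of d* while z is placed near any small vector.\<close>

lemma supports_near:
  assumes "w \<in> supp_w ob"
  shows "\<exists>ds \<eta>. \<eta> > 0 \<and> (\<forall>U. open U \<longrightarrow> U \<noteq> {} \<longrightarrow> U \<subseteq> {ds - \<eta><..<ds + \<eta>} \<times> ball 0 \<eta> \<longrightarrow>
    (\<exists>z\<in>supp_z ob w. \<exists>d\<in>supp_d ob z w. (d, z) \<in> U))"
proof -
  obtain ds U where U: "open U" "(ds, 0) \<in> U" "U \<subseteq> msupport (law_dz ob w)"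
    using normal[unfolded normalization_def, rule_format, OF assms] by (elim conjE exE)
  obtain A B where AB: "open A" "ds \<in> A" "open B" "0 \<in> B" "A \<times> B \<subseteq> U"
    using open_prod_elim[OF U(1,2)] by (metis mem_Times_iff fst_conv snd_conv)
  obtain \<eta>1 \<eta>2 where \<eta>: "\<eta>1 > 0" "ball ds \<eta>1 \<subseteq> A" "\<eta>2 > 0" "ball 0 \<eta>2 \<subseteq> B"
    using AB open_contains_ball by meson
  have "{ds - min \<eta>1 \<eta>2<..<ds + min \<eta>1 \<eta>2} \<times> ball 0 (min \<eta>1 \<eta>2) \<subseteq> U"
  proof -
    have "{ds - min \<eta>1 \<eta>2<..<ds + min \<eta>1 \<eta>2} \<subseteq> ball ds \<eta>1"
      by (auto simp: dist_real_def)
    moreover have "ball 0 (min \<eta>1 \<eta>2) \<subseteq> ball 0 \<eta>2" by auto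
    ultimately show ?thesis using \<eta> AB(5) by blast
  qed
  with U(3) have sub: "{ds - min \<eta>1 \<eta>2<..<ds + min \<eta>1 \<eta>2} \<times> ball 0 (min \<eta>1 \<eta>2) \<subseteq> msupport (law_dz ob w)"
    by blast
  show ?thesis
  proof (intro exI conjI allI impI)
    show "min \<eta>1 \<eta>2 > 0" using \<eta> by simp
    fix U' :: "(real \<times> (real ^ 'j)) set"
    assume "open U'" "U' \<noteq> {}" "U' \<subseteq> {ds - min \<eta>1 \<eta>2<..<ds + min \<eta>1 \<eta>2} \<times> ball 0 (min \<eta>1 \<eta>2)"
    with sub show "\<exists>z\<in>supp_z ob w. \<exists>d\<in>supp_d ob z w. (d, z) \<in> U'"
      by (intro open_meets_supports) blast+
  qed
qed

section \<open>Laws given x and the formula for \<open>p0\<close>\<close>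

lemma distr_ker_lat:
  assumes w: "w \<in> supp_w ob" and x: "(d, z, w) \<in> supp_x ob"
  shows "distr (ker_lat S (d, z, w)) borel (\<lambda>l. (lat_e l, lat_eps w l)) = law_e_w ob S w \<Otimes>\<^sub>M law_eps_w w"
proof -
  \<comment> \<open>Dropping (d, z) leaves independence of e and \<epsilon> given w. The version
    fixed in \<open>cond_independence\<close> then carries the product law to every x of the
    support.\<close>
  have "indep_rv (law_given_w ob S w) (\<lambda>(d, z, l). lat_eps w l) (\<lambda>x. (case x of (d, z, l) \<Rightarrow> lat_e l,
      case x of (d, z, l) \<Rightarrow> (d, z)))"
    using cond_indep w unfolding cond_independence_def by (simp add: split_def)
  then have "indep_rv (law_given_w ob S w) (\<lambda>(d, z, l). lat_e l) (\<lambda>(d, z, l). lat_eps w l)"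
    by (rule indep_rv_commute[OF prob_law_given_w indep_rv_fst[OF prob_law_given_w]])
  from distr_indep_rv[OF prob_law_given_w this]
  have "distr (law_given_w ob S w) borel (\<lambda>(d, z, l). (lat_e l, lat_eps w l)) = law_e_w ob S w \<Otimes>\<^sub>M law_eps_w w"
    by (simp add: law_e_w_def law_eps_w_def split_def)
  moreover have "distr (ker_lat S (d, z, w)) borel (\<lambda>l. (lat_e l, lat_eps w l)) =
        distr (law_given_w ob S w) borel (\<lambda>(d, z, l). (lat_e l, lat_eps w l))"
    using cond_indep[unfolded cond_independence_def, THEN conjunct2] x by (rule bspec[elim_format]) simp
  ultimately show ?thesis by simp
qed

lemma distr_ker_lat_e:
  assumes w: "w \<in> supp_w ob" and x: "(d, z, w) \<in> supp_x ob"
  shows "distr (ker_lat S (d, z, w)) borel lat_e = law_e_w ob S w"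
proof -
  interpret E: prob_space "law_eps_w w" by (rule prob_law_eps_w)
  have [measurable]: "(\<lambda>l :: ('k, 'j) latent. (lat_e l, lat_eps w l)) \<in> borel \<rightarrow>\<^sub>M borel"
    by measurable
  have [measurable]: "(fst :: real \<times> (real ^ 'j) \<Rightarrow> real) \<in> borel_measurable borel"
    unfolding borel_prod[symmetric] by measurable
  have "distr (ker_lat S (d, z, w)) borel lat_e
      = distr (distr (ker_lat S (d, z, w)) borel (\<lambda>l. (lat_e l, lat_eps w l))) borel fst"
    by (subst distr_distr) (auto simp: o_def)
  also have "\<dots> = distr (law_e_w ob S w \<Otimes>\<^sub>M law_eps_w w) (law_e_w ob S w) fst"
    unfolding distr_ker_lat[OF assms] by (intro distr_cong) (auto simp: law_e_w_def)
  also have "\<dots> = law_e_w ob S w"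
    by (rule E.distr_pair_fst)
  finally show ?thesis .
qed

text \<open>Given w, the laws of v are translates of one law. This is the form that
  \<open>boundedly_complete_no_gap\<close> expects, and it allows the law of e to be recovered by
  shifting back.\<close>

lemma law_v_x_eq:
  assumes "w \<in> supp_w ob" and "(d, z, w) \<in> supp_x ob"
  shows "law_v_x S (d, z, w) = distr (law_e_w ob S w) borel (\<lambda>e. (beta0 S w + beta1 S w * d) + e)"
  unfolding distr_ker_lat_e[OF assms, symmetric] law_v_x_def
  by (subst distr_distr) (auto simp: o_def index_v_def[abs_def])

text \<open>When z has components of both signs this function of t need not be monotone. Its values
  are the measures of the sections of a closed set, so it is measurable as in Fubini's
  theorem.\<close>

lemma measurable_cdf_ray [measurable]:
  "(\<lambda>t. measure (law_eps_w w) {.. - (t *\<^sub>R z)}) \<in> borel_measurable borel"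
proof -
  interpret E: prob_space "law_eps_w w" by (rule prob_law_eps_w)
  have "closed {(t :: real, x). x \<le> - (t *\<^sub>R z)}"
    unfolding less_eq_vec_def split_def
    by (intro closed_Collect_all closed_Collect_le continuous_intros)
  moreover have "sets ((borel :: real measure) \<Otimes>\<^sub>M law_eps_w w) = sets borel"
    unfolding sets_pair_measure_cong[OF refl sets_law_eps_w] borel_prod ..
  ultimately have "{(t :: real, x). x \<le> - (t *\<^sub>R z)} \<in> sets (borel \<Otimes>\<^sub>M law_eps_w w)"
    by simp
  from E.measurable_emeasure_Pair[OF this]
  have "(\<lambda>t. emeasure (law_eps_w w) {.. - (t *\<^sub>R z)}) \<in> borel_measurable borel"
    by (simp add: vimage_def atMost_def)
  then show ?thesis by (simp add: measure_def)
qed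

text \<open>The outside option is chosen iff \<epsilon> \<le> - v z in every component, ties
  included; the rest is Fubini for the independent e and \<epsilon>.\<close>

lemma p0_eq:
  assumes w: "w \<in> supp_w ob" and x: "(d, z, w) \<in> supp_x ob"
  shows "p0 S (d, z, w) = (LINT t|law_v_x S (d, z, w). measure (law_eps_w w) {.. - (t *\<^sub>R z)})"
proof -
  interpret E: prob_space "law_eps_w w" by (rule prob_law_eps_w)
  interpret Q: prob_space "law_e_w ob S w" by (rule prob_law_e_w)
  have pair[measurable]: "(\<lambda>l :: ('k, 'j) latent. (lat_e l, lat_eps w l)) \<in> borel \<rightarrow>\<^sub>M borel"
    by measurable
  define v where "v e = beta0 S w + beta1 S w * d + e" for e
  define A where "A = {(e, t). t \<le> - (v e *\<^sub>R z)}"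
  have "closed A"
    unfolding A_def less_eq_vec_def split_def v_def
    by (intro closed_Collect_all closed_Collect_le continuous_intros)
  moreover have "sets (law_e_w ob S w \<Otimes>\<^sub>M law_eps_w w) = sets borel"
    unfolding sets_pair_measure_cong[OF sets_law_e_w sets_law_eps_w] borel_prod ..
  ultimately have A: "A \<in> sets borel" "A \<in> sets (law_e_w ob S w \<Otimes>\<^sub>M law_eps_w w)"
    by simp_all
  have int: "integrable (law_e_w ob S w) (\<lambda>e. measure (law_eps_w w) {.. - (v e *\<^sub>R z)})"
    unfolding v_def
    by (intro Q.integrable_const_bound[where B = 1])
       (auto intro!: measurable_compose[OF _ measurable_cdf_ray] E.prob_le_1)
  have "emeasure (law_e_w ob S w \<Otimes>\<^sub>M law_eps_w w) A
      = (\<integral>\<^sup>+e. ennreal (measure (law_eps_w w) {.. - (v e *\<^sub>R z)}) \<partial>law_e_w ob S w)"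
    by (subst E.emeasure_pair_measure_alt[OF A(2)])
       (simp add: A_def vimage_def atMost_def E.emeasure_eq_measure)
  also have "\<dots> = ennreal (LINT e|law_e_w ob S w. measure (law_eps_w w) {.. - (v e *\<^sub>R z)})"
    by (intro nn_integral_eq_integral int) auto
  finally have A_eq: "measure (law_e_w ob S w \<Otimes>\<^sub>M law_eps_w w) A
      = (LINT e|law_e_w ob S w. measure (law_eps_w w) {.. - (v e *\<^sub>R z)})"
    by (simp add: measure_def)
  have "{l \<in> space (ker_lat S (d, z, w)). \<forall>y. utility S (d, z, w) l y \<le> utility S (d, z, w) l None}
      = (\<lambda>l. (lat_e l, lat_eps w l)) -` A \<inter> space (ker_lat S (d, z, w))"
  proof -
    have "(\<forall>y. utility S (d, z, w) l y \<le> utility S (d, z, w) l None) \<longleftrightarrow> (lat_e l, lat_eps w l) \<in> A" for l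
    proof -
      have "(\<forall>y. utility S (d, z, w) l y \<le> utility S (d, z, w) l None)
          \<longleftrightarrow> (\<forall>y. z $ y * v (lat_e l) + lat_eps w l $ y \<le> 0)"
        by (simp add: v_def split_option_all)
      also have "\<dots> \<longleftrightarrow> (\<forall>y. lat_eps w l $ y \<le> - (v (lat_e l) * z $ y))"
        by (intro all_cong1) (auto simp: algebra_simps)
      finally show ?thesis by (simp add: A_def less_eq_vec_def)
    qed
    then show ?thesis by auto
  qed
  then have "p0 S (d, z, w) = measure (distr (ker_lat S (d, z, w)) borel (\<lambda>l. (lat_e l, lat_eps w l))) A"
    using A(1) unfolding p0_def by (subst measure_distr) auto
  then show ?thesis
    unfolding distr_ker_lat[OF assms] A_eq law_v_x_eq[OF assms] by (subst integral_distr) (auto simp: v_def)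
qed

section \<open>Moments of e and density of the points - v z\<close>

lemma law_e_w_moments:
  assumes "w \<in> supp_w ob"
  shows "integrable (law_e_w ob S w) (\<lambda>e. e)" "(LINT e|law_e_w ob S w. e) = 0"
    "\<not> (AE e in law_e_w ob S w. e = 0)"
proof -
  have *: "integrable (law_e_w ob S w) (\<lambda>e. e)" "(LINT e|law_e_w ob S w. e) = 0"
    "(LINT e|law_e_w ob S w. (e - (LINT e|law_e_w ob S w. e))\<^sup>2) = 1"
    using normal assms unfolding normalization_def by auto
  then show "integrable (law_e_w ob S w) (\<lambda>e. e)" "(LINT e|law_e_w ob S w. e) = 0" by auto
  show "\<not> (AE e in law_e_w ob S w. e = 0)"
  proof
    assume "AE e in law_e_w ob S w. e = 0"
    then
    have "AE e in law_e_w ob S w. e\<^sup>2 = 0"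
      by eventually_elim simp
    then have "(LINT e|law_e_w ob S w. e\<^sup>2) = 0"
      by (rule integral_eq_zero_AE)
    then show False using * by simp
  qed
qed

lemma mean_law_v_x:
  assumes "w \<in> supp_w ob" and "(d, z, w) \<in> supp_x ob"
  shows "(LINT t|law_v_x S (d, z, w). t) = beta0 S w + beta1 S w * d"
proof -
  interpret Q: prob_space "law_e_w ob S w" by (rule prob_law_e_w)
  have "(LINT t|law_v_x S (d, z, w). t) = (LINT e|law_e_w ob S w. (beta0 S w + beta1 S w * d) + e)"
    unfolding law_v_x_eq[OF assms] by (rule integral_distr) auto
  also have "\<dots> = (beta0 S w + beta1 S w * d) + (LINT e|law_e_w ob S w. e)"
    by (subst Bochner_Integration.integral_add) (simp_all add: law_e_w_moments[OF assms(1)] Q.prob_space)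
  finally show ?thesis by (simp add: law_e_w_moments[OF assms(1)])
qed

lemma ray_points_dense:
  assumes w: "w \<in> supp_w ob" and "\<epsilon> > 0"
  shows "\<exists>z\<in>supp_z ob w. \<exists>d\<in>supp_d ob z w. \<exists>e\<in>msupport (law_e_w ob S w).
    norm (- ((beta0 S w + beta1 S w * d + e) *\<^sub>R z) - r) < \<epsilon>"
proof -
  interpret Q: prob_space "law_e_w ob S w" by (rule prob_law_e_w)
  obtain ds \<eta> where \<eta>: "\<eta> > 0" and near: "\<forall>U. open U \<longrightarrow> U \<noteq> {} \<longrightarrow>
      U \<subseteq> {ds - \<eta><..<ds + \<eta>} \<times> ball 0 \<eta> \<longrightarrow> (\<exists>z\<in>supp_z ob w. \<exists>d\<in>supp_d ob z w. (d, z) \<in> U)"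
    using supports_near[OF w] by blast
  \<comment> \<open>Only those z are used that occur with some d near d*. For such d the bound
    \<open>K\<close> on the index without e is uniform, so that one target can serve all z.\<close>
  define Z where "Z = {z \<in> supp_z ob w. \<exists>d\<in>supp_d ob z w. \<bar>d - ds\<bar> < \<eta>}"
  define V where "V z = {beta0 S w + beta1 S w * d + e | d e.
    d \<in> supp_d ob z w \<and> e \<in> msupport (law_e_w ob S w)}" for z
  define K where "K = \<bar>beta0 S w\<bar> + \<bar>beta1 S w\<bar> * (\<bar>ds\<bar> + \<eta>)"
  have K: "\<bar>beta0 S w + beta1 S w * d\<bar> \<le> K" if "\<bar>d - ds\<bar> < \<eta>" for d
  proof -
    have "\<bar>beta1 S w * d\<bar> \<le> \<bar>beta1 S w\<bar> * (\<bar>ds\<bar> + \<eta>)"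
      unfolding abs_mult using that by (intro mult_left_mono) auto
    then show ?thesis unfolding K_def by linarith
  qed
  have "K \<ge> 0" using \<eta> by (simp add: K_def)
  have supp_e: "AE e in law_e_w ob S w. e \<in> msupport (law_e_w ob S w)"
    by (rule AE_msupport[OF sets_law_e_w])
  have "\<exists>C. \<forall>n::real. \<exists>\<tau>. n \<le> \<bar>\<tau>\<bar> \<and> (\<forall>z\<in>Z. \<exists>t\<in>V z. \<bar>t - \<tau>\<bar> \<le> C)"
  proof (cases "\<exists>b. AE e in law_e_w ob S w. \<bar>e\<bar> \<le> b")
    case True
    then obtain b where b: "AE e in law_e_w ob S w. \<bar>e\<bar> \<le> b" by blast
    obtain \<zeta> where \<zeta>: "(LINT e|law_e_w ob S w. exp (\<zeta> * complex_of_real e)) = 0"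
      using exp_moment_has_zero[OF prob_law_e_w sets_law_e_w b law_e_w_moments(2,3)[OF w]] by blast
    \<comment> \<open>Far values of v are sought in the direction - \<sigma>, the one in which exp
      (\<zeta> t) may grow.\<close>
    define \<sigma> :: real where "\<sigma> = (if Re \<zeta> \<le> 0 then 1 else - 1)"
    have \<sigma>: "\<bar>\<sigma>\<bar> = 1" "\<sigma> * Re \<zeta> \<le> 0" "\<sigma> * \<sigma> = 1" by (auto simp: \<sigma>_def)
    have "\<not> (AE e in law_e_w ob S w. \<not> (e \<in> msupport (law_e_w ob S w) \<and> \<bar>e\<bar> \<le> b))"
    proof
      assume "AE e in law_e_w ob S w. \<not> (e \<in> msupport (law_e_w ob S w) \<and> \<bar>e\<bar> \<le> b)"
      with supp_e b have "AE e in law_e_w ob S w. False" by eventually_elim blast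
      then show False by simp
    qed
    then obtain e where e: "e \<in> msupport (law_e_w ob S w)" "\<bar>e\<bar> \<le> b"
      by (metis (mono_tags, lifting) AE_I2)
    \<comment> \<open>By the choice of \<open>K\<close> the target does not come before the index at
      any d near d*, seen in the direction - \<sigma>. The tolerance consists of 2 b for the index,
      from the absence of gaps, and b for e.\<close>
    have "\<exists>t\<in>V z. \<bar>t - - \<sigma> * max n K\<bar> \<le> 3 * b" if z: "z \<in> Z" for z n
    proof -
      obtain d where d: "z \<in> supp_z ob w" "d \<in> supp_d ob z w" "\<bar>d - ds\<bar> < \<eta>"
        using z by (auto simp: Z_def)
      define W where "W = (\<lambda>d. beta0 S w + beta1 S w * d) ` supp_d ob z w"
      have fam: "{distr (law_e_w ob S w) borel (\<lambda>e. v + e) | v. v \<in> W}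
          = {law_v_x S (d, z, w) | d. d \<in> supp_d ob z w}"
        by (simp add: W_def law_v_x_eq[OF w in_supp_x[OF w d(1)]] Setcompr_eq_image image_image cong: image_cong)
      have "\<sigma> * (- \<sigma> * max n K) \<le> \<sigma> * (beta0 S w + beta1 S w * d)"
      proof -
        have "\<bar>\<sigma> * (beta0 S w + beta1 S w * d)\<bar> \<le> K"
          using K[OF d(3)] \<sigma>(1) by (simp add: abs_mult)
        moreover have "\<sigma> * (- \<sigma> * max n K) = - ((\<sigma> * \<sigma>) * max n K)" by simp
        ultimately show ?thesis unfolding \<sigma>(3) by linarith
      qed
      moreover have "boundedly_complete {distr (law_e_w ob S w) borel (\<lambda>e. v + e) | v. v \<in> W}"
        unfolding fam using v_compl w d(1) by (auto simp: v_complete_def)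
      moreover have "beta0 S w + beta1 S w * d \<in> W" using d(2) by (auto simp: W_def)
      ultimately obtain v where "v \<in> W" "\<bar>v - - \<sigma> * max n K\<bar> \<le> 2 * b"
        using boundedly_complete_no_gap[OF prob_law_e_w sets_law_e_w b \<zeta> _ \<sigma>(1,2)] by blast
      then have "v + e \<in> V z" "\<bar>(v + e) - - \<sigma> * max n K\<bar> \<le> 3 * b"
        using e by (auto simp: V_def W_def)
      then show ?thesis by blast
    qed
    moreover have "n \<le> \<bar>- \<sigma> * max n K\<bar>" for n
      using \<sigma>(1) \<open>K \<ge> 0\<close> by (simp add: abs_mult)
    ultimately show ?thesis by blast
  next
    case False
    \<comment> \<open>When e is unbounded its own far support points are the targets; the index at a
      d near d* shifts them by at most \<open>K\<close>.\<close>
    have "\<exists>\<tau>. n \<le> \<bar>\<tau>\<bar> \<and> (\<forall>z\<in>Z. \<exists>t\<in>V z. \<bar>t - \<tau>\<bar> \<le> K)" for n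
    proof -
      have "\<exists>e\<in>msupport (law_e_w ob S w). \<bar>e\<bar> > n"
      proof (rule ccontr)
        assume "\<not> ?thesis"
        with supp_e have "AE e in law_e_w ob S w. \<bar>e\<bar> \<le> n"
          by (auto elim!: eventually_mono)
        with False show False by blast
      qed
      then obtain e where e: "e \<in> msupport (law_e_w ob S w)" "\<bar>e\<bar> > n" by blast
      have "\<exists>t\<in>V z. \<bar>t - e\<bar> \<le> K" if "z \<in> Z" for z
      proof -
        obtain d where d: "d \<in> supp_d ob z w" "\<bar>d - ds\<bar> < \<eta>"
          using \<open>z \<in> Z\<close> by (auto simp: Z_def)
        then have "beta0 S w + beta1 S w * d + e \<in> V z" using e(1) by (auto simp: V_def)
        then show ?thesis using K[OF d(2)] by force
      qed
      then show ?thesis using e(2) by (intro exI[of _ e]) auto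
    qed
    then show ?thesis by blast
  qed
  then obtain C where far: "\<And>n::real. \<exists>\<tau>. n \<le> \<bar>\<tau>\<bar> \<and> (\<forall>z\<in>Z. \<exists>t\<in>V z. \<bar>t - \<tau>\<bar> \<le> C)" by blast
  have "\<exists>z\<in>Z. \<exists>t\<in>V z. norm (- (t *\<^sub>R z) - r) < \<epsilon>"
  proof (rule dense_scaled_vectors[OF far _ \<eta> \<open>\<epsilon> > 0\<close>])
    fix z0 :: "real ^ 'j" and \<delta> :: real assume z0: "norm z0 < \<eta>" "\<delta> > 0"
    define U where "U = {ds - \<eta><..<ds + \<eta>} \<times> (ball 0 \<eta> \<inter> ball z0 \<delta>)"
    have "(ds, z0) \<in> U" using z0 \<eta> by (simp add: U_def)
    moreover have "open U" unfolding U_def by (intro open_Times open_Int) auto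
    ultimately obtain z d where zd: "z \<in> supp_z ob w" "d \<in> supp_d ob z w" "(d, z) \<in> U"
      using near[rule_format, of U] unfolding U_def by blast
    then have "z \<in> Z" "norm (z - z0) < \<delta>"
      by (auto simp: Z_def U_def dist_norm norm_minus_commute intro!: bexI[of _ d])
    then show "\<exists>z\<in>Z. norm (z - z0) < \<delta>" by blast
  qed
  then show ?thesis unfolding Z_def V_def by blast
qed

text \<open>Equality for almost all t gives equality somewhere in each open set: a support point of
  e whose point - v z lies in the set has a neighbourhood of positive mass with the same property,
  which no null set contains.\<close>

lemma law_eps_w_eqI:
  assumes w: "w \<in> supp_w ob" and R: "prob_space R" "sets R = sets borel"
    and eq: "\<And>z d. z \<in> supp_z ob w \<Longrightarrow> d \<in> supp_d ob z w \<Longrightarrow>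
      AE t in law_v_x S (d, z, w). measure (law_eps_w w) {.. - (t *\<^sub>R z)} = measure R {.. - (t *\<^sub>R z)}"
  shows "law_eps_w w = R"
proof (rule measure_eqI_dense_cdf)
  interpret E: prob_space "law_eps_w w" by (rule prob_law_eps_w)
  interpret R: prob_space R by (rule R)
  interpret Q: prob_space "law_e_w ob S w" by (rule prob_law_e_w)
  show "finite_measure (law_eps_w w)" "finite_measure R" by unfold_locales
  show "sets (law_eps_w w) = sets borel" "sets R = sets borel" by (rule sets_law_eps_w, rule R)
  fix U :: "(real ^ 'j) set" assume U: "open U" "U \<noteq> {}"
  then obtain r \<epsilon> where r: "\<epsilon> > 0" "ball r \<epsilon> \<subseteq> U"
    by (meson all_not_in_conv open_contains_ball)
  obtain z d e where zde: "z \<in> supp_z ob w" "d \<in> supp_d ob z w" "e \<in> msupport (law_e_w ob S w)"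
    "norm (- ((beta0 S w + beta1 S w * d + e) *\<^sub>R z) - r) < \<epsilon>"
    using ray_points_dense[OF w r(1), of r] by blast
  define N where "N = {e. - ((beta0 S w + beta1 S w * d + e) *\<^sub>R z) \<in> U}"
  have "open N"
    unfolding N_def using U(1) by (intro open_vimage[unfolded vimage_def] continuous_intros)
  moreover have "e \<in> N"
    using zde(4) r(2) by (auto simp: N_def dist_norm norm_minus_commute)
  ultimately have "emeasure (law_e_w ob S w) N > 0"
    using zde(3) by (auto simp: msupport_def)
  show "\<exists>x\<in>U. measure (law_eps_w w) {..x} = measure R {..x}"
  proof (rule ccontr)
    assume neg: "\<not> ?thesis"
    define v where "v e = (beta0 S w + beta1 S w * d) + e" for e
    have "AE t in distr (law_e_w ob S w) borel v.
        measure (law_eps_w w) {.. - (t *\<^sub>R z)} = measure R {.. - (t *\<^sub>R z)}"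
      using eq[OF zde(1,2)] unfolding law_v_x_eq[OF w in_supp_x[OF w zde(1,2)]] v_def .
    then have "AE e in law_e_w ob S w.
        measure (law_eps_w w) {.. - (v e *\<^sub>R z)} = measure R {.. - (v e *\<^sub>R z)}"
      by (rule AE_distrD[rotated]) (simp add: v_def[abs_def])
    then have "AE e in law_e_w ob S w. e \<notin> N"
      using neg by (auto simp: N_def v_def elim!: eventually_mono)
    moreover have "N \<in> sets (law_e_w ob S w)" using \<open>open N\<close> by (simp add: sets_law_e_w)
    ultimately have "emeasure (law_e_w ob S w) N = 0"
      using AE_iff_null_sets by blast
    with \<open>emeasure (law_e_w ob S w) N > 0\<close> show False by simp
  qed
qed

section \<open>The joint law of all variables and its disintegration over w\<close>

lemma measurable_law_all_kernel:
  "(\<lambda>w. law_given_w ob S w \<bind> (\<lambda>r. return borel (w, r))) \<in> borel \<rightarrow>\<^sub>M prob_algebra borel"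
proof -
  have "(\<lambda>w. law_given_w ob S w \<bind> (\<lambda>r. return (borel \<Otimes>\<^sub>M borel) (w, r)))
      \<in> borel \<rightarrow>\<^sub>M prob_algebra (borel \<Otimes>\<^sub>M borel)"
    by measurable
  then show ?thesis by (simp add: borel_prod)
qed

lemma prob_law_all: "prob_space (law_all ob S)"
  and sets_law_all [measurable_cong]: "sets (law_all ob S) = sets borel"
  using prob_space_bind'[OF law_w_prob measurable_law_all_kernel]
    sets_bind'[OF law_w_prob measurable_law_all_kernel]
  by (simp_all add: law_all_def)

lemma emeasure_law_all:
  assumes X: "X \<in> sets borel"
  shows "emeasure (law_all ob S) X = (\<integral>\<^sup>+w. emeasure (law_given_w ob S w) (Pair w -` X) \<partial>law_w ob)"
proof -
  have "emeasure (law_given_w ob S w \<bind> (\<lambda>r. return borel (w, r))) X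
      = emeasure (law_given_w ob S w) (Pair w -` X)" for w
  proof -
    have ret: "(\<lambda>r :: real \<times> (real ^ 'j) \<times> ('k, 'j) latent. return borel (w, r)) \<in> borel \<rightarrow>\<^sub>M prob_algebra borel"
      by (intro measurable_compose[OF _ measurable_return_prob_space] borel_measurable_Pair) auto
    have "Pair w \<in> borel_measurable (borel :: (real \<times> (real ^ 'j) \<times> ('k, 'j) latent) measure)"
      by (intro borel_measurable_continuous_onI continuous_intros)
    then have "Pair w -` X \<in> sets borel"
      using X by (rule measurable_sets_borel)
    have "emeasure (law_given_w ob S w \<bind> (\<lambda>r. return borel (w, r))) X
        = (\<integral>\<^sup>+r. indicator X (w, r) \<partial>law_given_w ob S w)"
      using X by (subst emeasure_bind_prob_algebra[OF law_given_w_space ret X]) simp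
    also have "\<dots> = (\<integral>\<^sup>+r. indicator (Pair w -` X) r \<partial>law_given_w ob S w)"
      by (intro nn_integral_cong) (simp add: indicator_def)
    also have "\<dots> = emeasure (law_given_w ob S w) (Pair w -` X)"
      using \<open>Pair w -` X \<in> sets borel\<close> by (intro nn_integral_indicator) (simp add: sets_law_given_w)
    finally show ?thesis .
  qed
  then show ?thesis
    unfolding law_all_def by (subst emeasure_bind_prob_algebra[OF law_w_prob measurable_law_all_kernel X]) simp
qed

lemma measurable_distr_law_given_w:
  assumes [measurable]: "f \<in> borel_measurable borel"
  shows "(\<lambda>w. distr (law_given_w ob S w) borel f) \<in> borel \<rightarrow>\<^sub>M prob_algebra borel"
  by measurable

lemma distr_law_all:
  assumes f[measurable]: "f \<in> borel_measurable borel"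
  shows "distr (law_all ob S) borel (\<lambda>(w, r). f r) = law_w ob \<bind> (\<lambda>w. distr (law_given_w ob S w) borel f)"
proof (rule measure_eqI)
  have "(\<lambda>x :: ('k, 'j) covs \<times> real \<times> (real ^ 'j) \<times> ('k, 'j) latent. f (snd x)) \<in> borel_measurable borel"
    by (rule measurable_compose[OF _ f]) (intro borel_measurable_continuous_onI continuous_intros)
  then have [measurable]: "(\<lambda>(w :: ('k, 'j) covs, r). f r) \<in> borel_measurable borel"
    by (simp add: split_def)
  show "sets (distr (law_all ob S) borel (\<lambda>(w, r). f r))
      = sets (law_w ob \<bind> (\<lambda>w. distr (law_given_w ob S w) borel f))"
    by (simp add: sets_bind'[OF law_w_prob measurable_distr_law_given_w])
  fix A assume "A \<in> sets (distr (law_all ob S) borel (\<lambda>(w, r). f r))"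
  then have A[measurable]: "A \<in> sets borel" by simp
  have "emeasure (distr (law_all ob S) borel (\<lambda>(w, r). f r)) A
      = emeasure (law_all ob S) ((\<lambda>(w, r). f r) -` A)"
    by (subst emeasure_distr) (auto simp: sets_eq_imp_space_eq[OF sets_law_all])
  also have "\<dots> = (\<integral>\<^sup>+w. emeasure (law_given_w ob S w) (f -` A) \<partial>law_w ob)"
    by (subst emeasure_law_all) (auto simp: vimage_def intro: measurable_sets_borel[of _ borel, unfolded vimage_def])
  also have "\<dots> = emeasure (law_w ob \<bind> (\<lambda>w. distr (law_given_w ob S w) borel f)) A"
    by (subst emeasure_bind_prob_algebra[OF law_w_prob measurable_distr_law_given_w A])
       (auto simp: emeasure_distr sets_eq_imp_space_eq[OF sets_law_given_w])
  finally show "emeasure (distr (law_all ob S) borel (\<lambda>(w, r). f r)) A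
      = emeasure (law_w ob \<bind> (\<lambda>w. distr (law_given_w ob S w) borel f)) A" .
qed

definition law_coef_w :: "('k, 'j) covs \<Rightarrow> ((real ^ 'k) \<times> (real ^ 'j)) measure" where
  "law_coef_w w = distr (law_given_w ob S w) borel (\<lambda>(d, z, l). lat_coef l)"

lemma measurable_given_coef: "(\<lambda>(d, z, l). lat_coef l) \<in> borel_measurable (law_given_w ob S w)"
  unfolding measurable_cong_sets[OF sets_law_given_w refl] by (rule measurable_snd_snd) measurable

lemma measurable_all_coef:
  "(\<lambda>(w, d, z, l). lat_coef l) \<in> borel_measurable (law_all ob S)"
  unfolding measurable_cong_sets[OF sets_law_all refl] split_def
  by (intro measurable_compose[OF _ measurable_lat_coef] borel_measurable_continuous_onI continuous_intros)

lemma law_coef_space: "law_coef ob S \<in> space (prob_algebra borel)"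
proof -
  interpret prob_space "law_all ob S" by (rule prob_law_all)
  have "prob_space (law_coef ob S)"
    unfolding law_coef_def by (rule prob_space_distr) (simp add: measurable_all_coef)
  then show ?thesis
    by (simp add: law_coef_def space_prob_algebra)
qed

text \<open>Independence factorizes the probability that the coefficients lie in A and w in B.
  Disintegrated over w, this is the hypothesis of \<open>AE_kernel_eq_const\<close>.\<close>

lemma AE_law_coef_w:
  assumes "coef_indep_w ob S"
  shows "AE w in law_w ob. law_coef_w w = law_coef ob S"
proof (rule AE_kernel_eq_const[OF law_w_prob _ law_coef_space])
  show "law_coef_w \<in> borel \<rightarrow>\<^sub>M prob_algebra borel"
    unfolding law_coef_w_def by (rule measurable_distr_law_given_w) measurable
  interpret prob_space "law_all ob S" by (rule prob_law_all)
  define c where "c = (\<lambda>(w :: ('k, 'j) covs, d :: real, z :: real ^ 'j, l :: ('k, 'j) latent). lat_coef l)"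
  have c: "c \<in> borel_measurable borel"
    using measurable_all_coef unfolding measurable_cong_sets[OF sets_law_all refl] c_def .
  have "(\<lambda>(w :: ('k, 'j) covs, d :: real, z :: real ^ 'j, l :: ('k, 'j) latent). w) = fst"
    by auto
  then have ind: "indep_rv (law_all ob S) c fst"
    using assms by (simp add: coef_indep_w_def c_def)
  fix A :: "((real ^ 'k) \<times> (real ^ 'j)) set" and B :: "('k, 'j) covs set"
  assume A[measurable]: "A \<in> sets borel" and B[measurable]: "B \<in> sets borel"
  have sp: "space (law_all ob S) = UNIV" "space (law_given_w ob S w) = UNIV" for w
    using sets_eq_imp_space_eq[OF sets_law_all] sets_eq_imp_space_eq[OF sets_law_given_w] by simp_all
  have [measurable]: "fst -` B \<in> sets (borel :: (('k, 'j) covs \<times> real \<times> (real ^ 'j) \<times> ('k, 'j) latent) measure)"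
    using B by (intro measurable_sets_borel[OF _ B] borel_measurable_continuous_onI continuous_intros)
  have cA[measurable]: "c -` A \<in> sets borel" by (rule measurable_sets_borel[OF c A])
  have "prob ((c -` A \<inter> space (law_all ob S)) \<inter> (fst -` B \<inter> space (law_all ob S)))
      = prob (c -` A \<inter> space (law_all ob S)) * prob (fst -` B \<inter> space (law_all ob S))"
    using ind A B unfolding indep_rv_def by (intro indep_setD[of "{c -` A \<inter> space (law_all ob S) | A. A \<in> sets borel}"
        "{fst -` B \<inter> space (law_all ob S) | B. B \<in> sets borel}"]) blast+
  then have "emeasure (law_all ob S) (c -` A \<inter> fst -` B)
      = emeasure (law_all ob S) (c -` A) * emeasure (law_all ob S) (fst -` B)"
    by (simp add: sp emeasure_eq_measure ennreal_mult'')
  also have "emeasure (law_all ob S) (c -` A) = emeasure (law_coef ob S) A"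
    using c by (simp add: law_coef_def c_def[symmetric] emeasure_distr sp measurable_cong_sets[OF sets_law_all refl])
  also have "emeasure (law_all ob S) (fst -` B) = emeasure (law_w ob) B"
  proof -
    have "emeasure (law_given_w ob S w) (Pair w -` fst -` B) = indicator B w" for w
      using prob_space.emeasure_space_1[OF prob_law_given_w[of w]]
      by (cases "w \<in> B") (simp_all add: vimage_def sp)
    then show ?thesis
      by (subst emeasure_law_all) (simp_all add: sets_law_w)
  qed
  also have "emeasure (law_all ob S) (c -` A \<inter> fst -` B) = (\<integral>\<^sup>+w\<in>B. emeasure (law_coef_w w) A \<partial>law_w ob)"
  proof -
    have "emeasure (law_given_w ob S w) (Pair w -` (c -` A \<inter> fst -` B))
        = emeasure (law_coef_w w) A * indicator B w" for w
    proof -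
      have "emeasure (law_coef_w w) A = emeasure (law_given_w ob S w) (Pair w -` (c -` A))"
        unfolding law_coef_w_def
        by (subst emeasure_distr[OF measurable_given_coef A]) (simp add: sp c_def vimage_def split_def)
      then show ?thesis by (cases "w \<in> B") (simp_all add: vimage_def)
    qed
    then show ?thesis by (subst emeasure_law_all) simp_all
  qed
  finally show "(\<integral>\<^sup>+w\<in>B. emeasure (law_coef_w w) A \<partial>law_w ob) = emeasure (law_coef ob S) A * emeasure (law_w ob) B" .
qed

lemma law_eps_w_law_coef_w: "law_eps_w w = distr (law_coef_w w) borel (coef_eps w)"
  using distr_distr[OF measurable_coef_eps measurable_given_coef]
  by (simp add: law_eps_w_def law_coef_w_def o_def lat_eps_eq split_def)

definition law_lat_w :: "('k, 'j) covs \<Rightarrow> ('k, 'j) latent measure" where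
  "law_lat_w w = distr (law_given_w ob S w) borel (\<lambda>(d, z, l). l)"

lemma law_lat_w_eq:
  assumes "coef_cond_indep_e ob S" "w \<in> supp_w ob"
  shows "law_lat_w w = distr (law_coef_w w \<Otimes>\<^sub>M law_e_w ob S w) borel (\<lambda>(u, e). (e, u))"
proof -
  have "indep_rv (law_given_w ob S w) (\<lambda>(d, z, l). lat_coef l) (\<lambda>(d, z, l). lat_e l)"
    using assms by (auto simp: coef_cond_indep_e_def)
  from distr_indep_rv[OF prob_law_given_w this]
  have eq: "law_coef_w w \<Otimes>\<^sub>M law_e_w ob S w
      = distr (law_given_w ob S w) borel (\<lambda>(d, z, l). (lat_coef l, lat_e l))"
    by (simp add: law_coef_w_def law_e_w_def split_def)
  have [measurable]: "(\<lambda>l :: ('k, 'j) latent. (lat_coef l, lat_e l)) \<in> borel \<rightarrow>\<^sub>M borel"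
    by measurable
  \<comment> \<open>Triples are nested pairs, so (e, u) with u = (\<theta>, \<zeta>) is the latent
    vector itself.\<close>
  have swap: "(\<lambda>(u :: (real ^ 'k) \<times> (real ^ 'j), e :: real). (e, u)) \<in> borel \<rightarrow>\<^sub>M borel"
    unfolding split_def by (intro borel_measurable_continuous_onI continuous_intros)
  have "(\<lambda>(d, z, l). (lat_coef l, lat_e l)) \<in> borel_measurable (law_given_w ob S w)"
    by measurable
  from distr_distr[OF swap this] show ?thesis
    unfolding eq law_lat_w_def by (simp add: o_def split_def lat_coef_def lat_e_def)
qed

lemma law_e_eq_bind: "law_e ob S = law_w ob \<bind> law_e_w ob S"
proof -
  have "(\<lambda>(w :: ('k, 'j) covs, r). (\<lambda>(d :: real, z :: real ^ 'j, l :: ('k, 'j) latent). lat_e l) r)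
      = (\<lambda>(w, d, z, l). lat_e l)"
    by (auto simp: fun_eq_iff)
  then show ?thesis
    using distr_law_all[of "\<lambda>(d, z, l). lat_e l"] by (simp add: law_e_def law_e_w_def[abs_def])
qed

lemma law_latent_eq_bind: "law_latent ob S = law_w ob \<bind> law_lat_w"
proof -
  have "(\<lambda>(w :: ('k, 'j) covs, r). (\<lambda>(d :: real, z :: real ^ 'j, l :: ('k, 'j) latent). l) r)
      = (\<lambda>(w, d, z, l). l)"
    by (auto simp: fun_eq_iff)
  then show ?thesis
    using distr_law_all[OF measurable_snd_snd[of "\<lambda>l. l"]] by (simp add: law_latent_def law_lat_w_def[abs_def])
qed

lemma measurable_law_e_w: "law_e_w ob S \<in> borel \<rightarrow>\<^sub>M prob_algebra borel"
  unfolding law_e_w_def[abs_def] by (rule measurable_distr_law_given_w) measurable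

lemma measurable_law_lat_w: "law_lat_w \<in> borel \<rightarrow>\<^sub>M prob_algebra borel"
  unfolding law_lat_w_def[abs_def] by (rule measurable_distr_law_given_w) measurable

end

section \<open>Equivalent structures\<close>

locale equivalent_structures = S: choice_model ob S \<kappa> + S': choice_model ob S' \<kappa>
  for ob :: "('k::finite, 'j::finite) observables" and S S' \<kappa> +
  assumes p0_agree: "\<And>x. x \<in> supp_x ob \<Longrightarrow> p0 S x = p0 S' x"
    and law_v_agree: "\<And>x. x \<in> supp_x ob \<Longrightarrow> law_v_x S x = law_v_x S' x"
begin

text \<open>The mean of v does not involve z, so two values of d on either side of d* suffice even
  if they occur with different z.\<close>

lemma beta_eq:
  assumes w: "w \<in> supp_w ob"
  shows "beta0 S w = beta0 S' w" "beta1 S w = beta1 S' w"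
proof -
  obtain ds \<eta> where \<eta>: "\<eta> > 0" and near: "\<forall>U. open U \<longrightarrow> U \<noteq> {} \<longrightarrow>
      U \<subseteq> {ds - \<eta><..<ds + \<eta>} \<times> ball 0 \<eta> \<longrightarrow> (\<exists>z\<in>supp_z ob w. \<exists>d\<in>supp_d ob z w. (d, z) \<in> U)"
    using S.supports_near[OF w] by blast
  have eq: "beta0 S w + beta1 S w * d = beta0 S' w + beta1 S' w * d"
    if "z \<in> supp_z ob w" "d \<in> supp_d ob z w" for z d
    using S.mean_law_v_x[OF w S.in_supp_x[OF w that]] S'.mean_law_v_x[OF w S.in_supp_x[OF w that]]
      law_v_agree[OF S.in_supp_x[OF w that]] by simp
  have open_box: "open ({a<..<b} \<times> ball (0 :: real ^ 'j) \<eta>)" for a b :: real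
    by (intro open_Times) auto
  have sub: "{ds - \<eta><..<ds} \<times> ball 0 \<eta> \<subseteq> {ds - \<eta><..<ds + \<eta>} \<times> ball (0 :: real ^ 'j) \<eta>"
    "{ds<..<ds + \<eta>} \<times> ball 0 \<eta> \<subseteq> {ds - \<eta><..<ds + \<eta>} \<times> ball (0 :: real ^ 'j) \<eta>"
    using \<eta> by (intro Sigma_mono; force)+
  obtain z1 d1 where 1: "z1 \<in> supp_z ob w" "d1 \<in> supp_d ob z1 w" "d1 < ds"
    using near[rule_format, OF open_box _ sub(1)] \<eta> by auto
  obtain z2 d2 where 2: "z2 \<in> supp_z ob w" "d2 \<in> supp_d ob z2 w" "ds < d2"
    using near[rule_format, OF open_box _ sub(2)] \<eta> by auto
  have "(beta1 S w - beta1 S' w) * (d2 - d1) = 0"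
    using eq[OF 1(1,2)] eq[OF 2(1,2)] by (simp add: algebra_simps)
  then show "beta1 S w = beta1 S' w" using 1(3) 2(3) by simp
  with eq[OF 1(1,2)] show "beta0 S w = beta0 S' w" by simp
qed

lemma law_e_w_eq:
  assumes w: "w \<in> supp_w ob"
  shows "law_e_w ob S w = law_e_w ob S' w"
proof -
  obtain ds \<eta> where \<eta>: "\<eta> > 0" and near: "\<forall>U. open U \<longrightarrow> U \<noteq> {} \<longrightarrow>
      U \<subseteq> {ds - \<eta><..<ds + \<eta>} \<times> ball 0 \<eta> \<longrightarrow> (\<exists>z\<in>supp_z ob w. \<exists>d\<in>supp_d ob z w. (d, z) \<in> U)"
    using S.supports_near[OF w] by blast
  have "open ({ds - \<eta><..<ds + \<eta>} \<times> ball (0 :: real ^ 'j) \<eta>)"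
    by (intro open_Times) auto
  then obtain z d where zd: "z \<in> supp_z ob w" "d \<in> supp_d ob z w"
    using near[rule_format, of "{ds - \<eta><..<ds + \<eta>} \<times> ball (0 :: real ^ 'j) \<eta>"] \<eta> by auto
  note x = S.in_supp_x[OF w zd]
  define a where "a = beta0 S w + beta1 S w * d"
  have shift: "distr (distr Q borel (\<lambda>e. a + e)) borel (\<lambda>t. t - a) = Q" if "sets Q = sets borel" for Q
    by (subst distr_distr) (auto simp: o_def that measurable_cong_sets[OF that refl] intro!: distr_id2)
  show ?thesis
    using law_v_agree[OF x] shift[OF S.sets_law_e_w] shift[OF S'.sets_law_e_w]
    unfolding S.law_v_x_eq[OF w x] S'.law_v_x_eq[OF w x] beta_eq[OF w, symmetric] a_def by metis
qed

lemma law_eps_w_eq: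
  assumes w: "w \<in> supp_w ob"
  shows "S.law_eps_w w = S'.law_eps_w w"
proof (rule S.law_eps_w_eqI[OF w S'.prob_law_eps_w S'.sets_law_eps_w])
  fix z d assume z: "z \<in> supp_z ob w" and d: "d \<in> supp_d ob z w"
  define g where "g t = measure (S.law_eps_w w) {.. - (t *\<^sub>R z)} - measure (S'.law_eps_w w) {.. - (t *\<^sub>R z)}" for t
  interpret R: prob_space "S.law_eps_w w" by (rule S.prob_law_eps_w)
  interpret R': prob_space "S'.law_eps_w w" by (rule S'.prob_law_eps_w)
  have [measurable]: "g \<in> borel_measurable borel"
    unfolding g_def by measurable
  have "bounded (range g)"
  proof (rule boundedI)
    fix y assume "y \<in> range g"
    then obtain t where "y = g t" by blast
    then show "norm y \<le> 1"
      using R.prob_le_1 R'.prob_le_1 measure_nonneg unfolding g_def real_norm_def by (smt (verit))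
  qed
  moreover have "\<forall>N\<in>{law_v_x S (d, z, w) | d. d \<in> supp_d ob z w}. (LINT t|N. g t) = 0"
  proof
    fix N assume N: "N \<in> {law_v_x S (d, z, w) | d. d \<in> supp_d ob z w}"
    obtain d' where d': "N = law_v_x S (d', z, w)" "d' \<in> supp_d ob z w" using N by blast
    note x = S.in_supp_x[OF w z d'(2)]
    interpret Q: prob_space "law_e_w ob S w" by (rule S.prob_law_e_w)
    interpret V: prob_space "law_v_x S (d', z, w)"
      unfolding S.law_v_x_eq[OF w x] by (rule Q.prob_space_distr) simp
    have [measurable_cong]: "sets (law_v_x S (d', z, w)) = sets borel"
      unfolding S.law_v_x_eq[OF w x] by simp
    have "integrable (law_v_x S (d', z, w)) (\<lambda>t. measure (S.law_eps_w w) {.. - (t *\<^sub>R z)})"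
      "integrable (law_v_x S (d', z, w)) (\<lambda>t. measure (S'.law_eps_w w) {.. - (t *\<^sub>R z)})"
      by (intro V.integrable_const_bound[where B = 1]; simp)+
    then have "(LINT t|N. g t) = p0 S (d', z, w) - p0 S' (d', z, w)"
      unfolding d'(1) g_def S.p0_eq[OF w x] S'.p0_eq[OF w x] law_v_agree[OF x, symmetric] by simp
    then show "(LINT t|N. g t) = 0" using p0_agree[OF x] by simp
  qed
  moreover have "boundedly_complete {law_v_x S (d, z, w) | d. d \<in> supp_d ob z w}"
    using S.v_compl w z by (simp add: v_complete_def)
  ultimately have "\<forall>N\<in>{law_v_x S (d, z, w) | d. d \<in> supp_d ob z w}. AE t in N. g t = 0"
    using \<open>g \<in> borel_measurable borel\<close> unfolding boundedly_complete_def by (elim allE[of _ g] impE) simp_all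
  then have "AE t in law_v_x S (d, z, w). g t = 0"
    using d by blast
  then show "AE t in law_v_x S (d, z, w).
      measure (S.law_eps_w w) {.. - (t *\<^sub>R z)} = measure (S'.law_eps_w w) {.. - (t *\<^sub>R z)}"
    by eventually_elim (simp add: g_def)
qed

lemma AE_supp_w: "AE w in law_w ob. w \<in> supp_w ob"
  unfolding supp_w_def by (rule AE_msupport[OF S.sets_law_w])

lemma law_e_eq: "law_e ob S = law_e ob S'"
  unfolding S.law_e_eq_bind S'.law_e_eq_bind
proof (rule bind_cong_AE'[OF S.law_w_prob S.measurable_law_e_w S'.measurable_law_e_w])
  show "AE w in law_w ob. law_e_w ob S w = law_e_w ob S' w"
    using AE_supp_w by eventually_elim (rule law_e_w_eq)
qed

lemma law_coef_eq:
  assumes ball: "r > 0" "ball c r \<subseteq> supp_w ob"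
    and indep: "coef_indep_w ob S" "coef_indep_w ob S'"
    and fin: "finite_abs_moments (law_coef ob S)" "finite_abs_moments (law_coef ob S')"
    and det: "moment_determinate (law_coef ob S)"
  shows "law_coef ob S = law_coef ob S'"
proof -
  have sets: "sets (law_coef ob S) = sets borel" "sets (law_coef ob S') = sets borel"
    and prob: "prob_space (law_coef ob S')"
    using S.law_coef_space S'.law_coef_space by (auto simp: space_prob_algebra)
  \<comment> \<open>The laws of \<epsilon> agree at every w of the support. The null set comes from
    replacing the conditional laws of the coefficients by the unconditional ones.\<close>
  have AE: "AE w in law_w ob. w \<in> supp_w ob \<and> S.law_coef_w w = law_coef ob S \<and> S'.law_coef_w w = law_coef ob S'"
    using AE_supp_w S.AE_law_coef_w[OF indep(1)] S'.AE_law_coef_w[OF indep(2)] by eventually_elim simp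
  have "(LINT u|law_coef ob S. monomial a b u) = (LINT u|law_coef ob S'. monomial a b u)" for a b
  proof (rule monomial_integral_eq[OF fin(1) sets(1) fin(2) sets(2) \<open>r > 0\<close>])
    fix U assume U: "open U" "U \<noteq> {}" "U \<subseteq> ball c r"
    \<comment> \<open>An open set that meets the support has positive mass, so what holds for almost
      every w holds at some w in it.\<close>
    then obtain w0 where "w0 \<in> U" "w0 \<in> supp_w ob" using ball by blast
    then have pos: "emeasure (law_w ob) U > 0"
      using U(1) by (auto simp: supp_w_def msupport_def)
    show "\<exists>w\<in>U. distr (law_coef ob S) borel (coef_eps w) = distr (law_coef ob S') borel (coef_eps w)"
    proof (rule ccontr)
      assume neg: "\<not> ?thesis"
      from AE have "AE w in law_w ob. w \<notin> U"
      proof eventually_elim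
        case (elim w)
        then have "distr (law_coef ob S) borel (coef_eps w) = distr (law_coef ob S') borel (coef_eps w)"
          using law_eps_w_eq[of w] by (simp add: S.law_eps_w_law_coef_w S'.law_eps_w_law_coef_w)
        then show ?case using neg by blast
      qed
      moreover have "U \<in> sets (law_w ob)" using U(1) by (simp add: S.sets_law_w)
      ultimately have "emeasure (law_w ob) U = 0"
        using AE_iff_null_sets by blast
      with pos show False by simp
    qed
  qed
  then show ?thesis
    using det prob sets(2) fin(2) by (auto simp: moment_determinate_def)
qed

lemma law_latent_eq:
  assumes coef: "law_coef ob S = law_coef ob S'"
    and indep: "coef_indep_w ob S" "coef_indep_w ob S'"
    and cond: "coef_cond_indep_e ob S" "coef_cond_indep_e ob S'"
  shows "law_latent ob S = law_latent ob S'"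
  unfolding S.law_latent_eq_bind S'.law_latent_eq_bind
proof (rule bind_cong_AE'[OF S.law_w_prob S.measurable_law_lat_w S'.measurable_law_lat_w])
  show "AE w in law_w ob. S.law_lat_w w = S'.law_lat_w w"
    using AE_supp_w S.AE_law_coef_w[OF indep(1)] S'.AE_law_coef_w[OF indep(2)]
    by eventually_elim (simp add: S.law_lat_w_eq S'.law_lat_w_eq cond law_e_w_eq coef)
qed

end

theorem corollary3p3:
  fixes ob :: "('k::finite, 'j::finite) observables"
    and C :: "('k, 'j) struct set"
    and \<kappa> :: enat
  assumes "valid_observables ob"
    and "\<And>S. S \<in> C \<Longrightarrow> valid_struct ob S"
    and "\<And>S. S \<in> C \<Longrightarrow> cond_independence ob S"
    and "\<And>S. S \<in> C \<Longrightarrow> normalization \<kappa> ob S"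
    and "identified ob C (\<lambda>S. restrict (law_v_x S) (supp_x ob))"
    and "\<And>S. S \<in> C \<Longrightarrow> v_complete ob S"
    and "\<And>S w. S \<in> C \<Longrightarrow> w \<in> supp_w ob \<Longrightarrow> index_range ob S w = UNIV"
    and "\<And>S. S \<in> C \<Longrightarrow> coef_indep_w ob S"
    and "\<exists>c r. r > 0 \<and> ball c r \<subseteq> supp_w ob"
    and "\<And>S. S \<in> C \<Longrightarrow> finite_abs_moments (law_coef ob S)"
    and "\<And>S. S \<in> C \<Longrightarrow> moment_determinate (law_coef ob S)"
  shows "identified ob C (\<lambda>S. restrict (beta0 S) (supp_w ob)) \<and>
    identified ob C (\<lambda>S. restrict (beta1 S) (supp_w ob)) \<and>
    identified ob C (\<lambda>S. restrict (law_e_w ob S) (supp_w ob)) \<and>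
    identified ob C (law_e ob) \<and>
    identified ob C (law_coef ob) \<and>
    identified ob {S \<in> C. coef_cond_indep_e ob S} (law_latent ob)"
proof -
  obtain c r where ball: "r > 0" "ball c r \<subseteq> supp_w ob" using assms(9) by blast
  have equiv: "equivalent_structures ob S S' \<kappa>"
    if "S \<in> C" "S' \<in> C" "\<forall>x\<in>supp_x ob. p0 S x = p0 S' x" for S S'
  proof -
    \<comment> \<open>Identification of the law of v given x turns equal choice probabilities into
      equal laws of v, the second requirement of \<open>equivalent_structures\<close>.\<close>
    have "restrict (law_v_x S) (supp_x ob) = restrict (law_v_x S') (supp_x ob)"
      using assms(5) that unfolding identified_def by blast
    then have "law_v_x S x = law_v_x S' x" if "x \<in> supp_x ob" for x
      using that by (metis restrict_apply')
    then show ?thesis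
      using that assms(1-4,6) by unfold_locales auto
  qed
  have coef: "law_coef ob S = law_coef ob S'"
    if "S \<in> C" "S' \<in> C" "\<forall>x\<in>supp_x ob. p0 S x = p0 S' x" for S S'
    using equivalent_structures.law_coef_eq[OF equiv[OF that] ball] that assms(8,10,11) by blast
  have latent: "law_latent ob S = law_latent ob S'"
    if "S \<in> C" "S' \<in> C" "\<forall>x\<in>supp_x ob. p0 S x = p0 S' x" "coef_cond_indep_e ob S" "coef_cond_indep_e ob S'"
    for S S'
    using equivalent_structures.law_latent_eq[OF equiv[OF that(1-3)] coef[OF that(1-3)]] that assms(8) by blast
  have "identified ob C (\<lambda>S. restrict (beta0 S) (supp_w ob))"
    unfolding identified_def
    by (intro ballI impI restrict_ext, rule equivalent_structures.beta_eq(1)[OF equiv])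
  moreover have "identified ob C (\<lambda>S. restrict (beta1 S) (supp_w ob))"
    unfolding identified_def
    by (intro ballI impI restrict_ext, rule equivalent_structures.beta_eq(2)[OF equiv])
  moreover have "identified ob C (\<lambda>S. restrict (law_e_w ob S) (supp_w ob))"
    unfolding identified_def
    by (intro ballI impI restrict_ext, rule equivalent_structures.law_e_w_eq[OF equiv])
  moreover have "identified ob C (law_e ob)"
    unfolding identified_def
    by (intro ballI impI, rule equivalent_structures.law_e_eq[OF equiv])
  moreover have "identified ob C (law_coef ob)"
    unfolding identified_def
    by (intro ballI impI, rule coef)
  moreover have "identified ob {S \<in> C. coef_cond_indep_e ob S} (law_latent ob)"
    unfolding identified_def using latent by simp
  ultimately show ?thesis by blast
qed

end
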